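(* Let $N\ge2$ and $T\ge1$ be integers, and let $l_{i,t}$ (losses) and $\lambda_{i,t}$ (lower bounds), $1\le i\le N$, $1\le t\le T$, be real numbers with $\lambda_{i,t}\le l_{i,t}$, fixed in advance (oblivious adversary). Put $s_{i,t}=l_{i,t}-\lambda_{i,t}$, $\mathbf{s}_t=(s_{1,t},\ldots,s_{N,t})$, $\boldsymbol{\lambda}_t=(\lambda_{1,t},\ldots,\lambda_{N,t})$. Let $0<\delta<1$, let $\mathcal{Q}>0$ be an upper bound on $$\frac{1}{2} q(\boldsymbol{\lambda}_{1:T})+2\sum_{t=1}^T \|\mathbf{s}_t\|^2+4\sum_{t=1}^T \max_i\{s_{i,t}\}\cdot d(\boldsymbol{\lambda}_t),$$ and set $\eta = \sqrt{\frac{4}{\mathcal{Q}}\log N}$. Consider the algorithm Exp3.LB.P with parameters $\eta$ and $\beta$. (i) If $\beta = \sqrt{\frac{2}{\mathcal{Q}}\log\frac{N+3}{\delta}}$, then assuming $\beta\max_{i,t}\{ s_{i,t}\} \leq 1$, it holds with probability at least $1-\delta$ that $R_{Exp3.LB.P,T} = O\left(\sqrt{\mathcal{Q}\log\frac{N}{\delta}}\right)$. (ii) If $\beta = \sqrt{\frac{2}{\mathcal{Q}}}$, then with probability at least $1-\delta$, $R_{Exp3.LB.P,T} = O\left(\sqrt{\mathcal{Q}}\cdot \log\frac{N}{\delta}\right)$. (iii) Suppose that $l_{i,t}\in[0,1]$ and $\lambda_{i,t}\ge0$ for every $i$ and $t$, and that $\mathcal{Q}\ge 2T$. Setting $$\beta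 = \min\left\{1,\sqrt{\frac{2}{\mathcal{Q}}\log\frac{N+3}{\delta}}\right\}$$ yields that $R_{Exp3.LB.P,T} = O\left(\sqrt{\mathcal{Q}\log(N/\delta)}\right)$ with probability at least $1-\delta$. For suitable admissible choices of $\mathcal{Q}$, this bound implies the regret bound $O(\sqrt{NT\log(N/\delta)})$ (with probability at least $1-\delta$) in the bandit setting ($\lambda_{i,t}=0$ for all $i,t$) and the regret bound $O(\sqrt{T\log(N/\delta)})$ (with probability at least $1-\delta$) in the full-information setting ($\lambda_{i,t}=l_{i,t}$ for all $i,t$). Here the constants in the $O(\cdot)$ are absolute (independent of $N$, $T$, $\delta$, $\mathcal{Q}$, the losses and the lower bounds).
   Context: Notation: $\|\cdot\|$ is the Euclidean norm; for $\mathbf{x}\in\mathbb{R}^N$, $d(\mathbf{x})=\max_i\{x_i\}-\min_i\{x_i\}$; for vectors $\mathbf{x}_1,\ldots,\mathbf{x}_T\in\mathbb{R}^N$, $q(\mathbf{x}_{1:T})=\sum_{t=1}^T d(\mathbf{x}_t)^2$; $\log$ is the natural logarithm. Model: there are $N$ experts and $T$ rounds. On each round $t$ the learner picks a probability distribution $\mathbf{p}_t$ on $\{1,\ldots,N\}$ (depending on past observations), draws $I_t\sim\mathbf{p}_t$ (conditionally on the past), incurs loss $l_{I_t,t}$, and observes $l_{I_t,t}$ and all of $\lambda_{1,t},\ldots,\lambda_{N,t}$. Exp3.LB.P with parameters $\eta>0$, $\beta\ge0$: $\mathbf{p}_1$ is uniform and $\widetilde{L}_{i,0}=0$ for all $i$.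 On each round $t=1,\ldots,T$: draw $I_t\sim\mathbf{p}_t$; define $$x_{i,t} = \frac{\beta s_{i,t}(1- p_{i,t})}{p_{i,t}(1-\beta s_{i,t})+\beta s_{i,t}(1-p_{i,t})}$$ (only the value for $i=I_t$ needs to be computed); set $\widetilde{l}_{i,t} = \frac{s_{i,t}(1-x_{i,t})}{p_{i,t}}\mathbb{I}\{I_t=i\}+\lambda_{i,t}$ and $\widetilde{L}_{i,t}=\widetilde{L}_{i,t-1}+\widetilde{l}_{i,t}$ for every $i$; set $p_{i,t+1}=\exp(-\eta \widetilde{L}_{i,t})/\sum_{k=1}^N\exp(-\eta\widetilde{L}_{k,t})$. The regret is the random variable $R_{Exp3.LB.P,T}=\sum_{t=1}^T l_{I_t,t}-\min_j\sum_{t=1}^T l_{j,t}$. *)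

theory Defs
  imports "HOL-Probability.Probability"
begin

text \<open>
  Experts are the indices \<open>{1..N}\<close> and rounds the indices \<open>{1..T}\<close>; a family such as
  \<open>l i t\<close> takes the expert first and the round second. Values outside these ranges are
  irrelevant.
\<close>

definition spread :: "nat \<Rightarrow> (nat \<Rightarrow> real) \<Rightarrow> real" where
  "spread N x = Max (x ` {1..N}) - Min (x ` {1..N})"

definition quad_spread :: "nat \<Rightarrow> nat \<Rightarrow> (nat \<Rightarrow> nat \<Rightarrow> real) \<Rightarrow> real" where
  "quad_spread N T x = (\<Sum>t=1..T. (spread N (\<lambda>i. x i t))\<^sup>2)"

definition slack :: "(nat \<Rightarrow> nat \<Rightarrow> real) \<Rightarrow> (nat \<Rightarrow> nat \<Rightarrow> real) \<Rightarrow> nat \<Rightarrow> nat \<Rightarrow> real" where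
  "slack l lam i t = l i t - lam i t"

definition loss_quantity ::
  "nat \<Rightarrow> nat \<Rightarrow> (nat \<Rightarrow> nat \<Rightarrow> real) \<Rightarrow> (nat \<Rightarrow> nat \<Rightarrow> real) \<Rightarrow> real" where
  "loss_quantity N T l lam =
     1/2 * quad_spread N T lam
     + 2 * (\<Sum>t=1..T. (L2_set (\<lambda>i. slack l lam i t) {1..N})\<^sup>2)
     + 4 * (\<Sum>t=1..T. Max ((\<lambda>i. slack l lam i t) ` {1..N}) * spread N (\<lambda>i. lam i t))"

definition exp3_instance ::
  "nat \<Rightarrow> nat \<Rightarrow> (nat \<Rightarrow> nat \<Rightarrow> real) \<Rightarrow> (nat \<Rightarrow> nat \<Rightarrow> real) \<Rightarrow> real \<Rightarrow> real \<Rightarrow> bool" where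
  "exp3_instance N T l lam \<delta> Q \<longleftrightarrow>
     2 \<le> N \<and> 1 \<le> T \<and> (\<forall>i\<in>{1..N}. \<forall>t\<in>{1..T}. lam i t \<le> l i t) \<and>
     0 < \<delta> \<and> \<delta> < 1 \<and> 0 < Q \<and> loss_quantity N T l lam \<le> Q"

definition max_slack :: "nat \<Rightarrow> nat \<Rightarrow> (nat \<Rightarrow> nat \<Rightarrow> real) \<Rightarrow> (nat \<Rightarrow> nat \<Rightarrow> real) \<Rightarrow> real" where
  "max_slack N T l lam = Max ((\<lambda>(i, t). slack l lam i t) ` ({1..N} \<times> {1..T}))"

definition exp_weight :: "nat \<Rightarrow> real \<Rightarrow> (nat \<Rightarrow> real) \<Rightarrow> nat \<Rightarrow> real" where
  "exp_weight N \<eta> L i = exp (- \<eta> * L i) / (\<Sum>k=1..N. exp (- \<eta> * L k))"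

definition shrinkage :: "real \<Rightarrow> real \<Rightarrow> real \<Rightarrow> real" where
  "shrinkage \<beta> s p = \<beta> * s * (1 - p) / (p * (1 - \<beta> * s) + \<beta> * s * (1 - p))"

text \<open>
  \<open>exp3_est N \<eta> \<beta> l lam I t i\<close> is the cumulative loss estimate of expert \<open>i\<close> after \<open>t\<close>
  rounds when the draws are \<open>I 1, I 2, \<dots>\<close>; it depends only on \<open>I 1, \<dots>, I t\<close>. The weights
  built from the estimates after \<open>t\<close> rounds are the probabilities used in round \<open>Suc t\<close>.
\<close>

primrec exp3_est ::
  "nat \<Rightarrow> real \<Rightarrow> real \<Rightarrow> (nat \<Rightarrow> nat \<Rightarrow> real) \<Rightarrow> (nat \<Rightarrow> nat \<Rightarrow> real) \<Rightarrow> (nat \<Rightarrow> nat)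
    \<Rightarrow> nat \<Rightarrow> nat \<Rightarrow> real" where
  "exp3_est N \<eta> \<beta> l lam I 0 = (\<lambda>i. 0)"
| "exp3_est N \<eta> \<beta> l lam I (Suc t) =
     (\<lambda>i. let s = slack l lam i (Suc t);
              p = exp_weight N \<eta> (exp3_est N \<eta> \<beta> l lam I t) i
          in exp3_est N \<eta> \<beta> l lam I t i
             + (s * (1 - shrinkage \<beta> s p) / p * of_bool (I (Suc t) = i) + lam i (Suc t)))"

definition exp3_draw ::
  "nat \<Rightarrow> real \<Rightarrow> (nat \<Rightarrow> real) \<Rightarrow> nat pmf" where
  "exp3_draw N \<eta> L = embed_pmf (\<lambda>i. if i \<in> {1..N} then exp_weight N \<eta> L i else 0)"

text \<open>
  The joint law of the draws of the first \<open>t\<close> rounds, as a distribution on sequences whose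
  entries outside \<open>{1..t}\<close> are the dummy value \<open>0\<close>.
\<close>

primrec exp3_run ::
  "nat \<Rightarrow> real \<Rightarrow> real \<Rightarrow> (nat \<Rightarrow> nat \<Rightarrow> real) \<Rightarrow> (nat \<Rightarrow> nat \<Rightarrow> real) \<Rightarrow> nat
    \<Rightarrow> (nat \<Rightarrow> nat) pmf" where
  "exp3_run N \<eta> \<beta> l lam 0 = return_pmf (\<lambda>_. 0)"
| "exp3_run N \<eta> \<beta> l lam (Suc t) =
     bind_pmf (exp3_run N \<eta> \<beta> l lam t) (\<lambda>I.
       map_pmf (\<lambda>i. I(Suc t := i)) (exp3_draw N \<eta> (exp3_est N \<eta> \<beta> l lam I t)))"

definition regret :: "nat \<Rightarrow> nat \<Rightarrow> (nat \<Rightarrow> nat \<Rightarrow> real) \<Rightarrow> (nat \<Rightarrow> nat) \<Rightarrow> real" where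
  "regret N T l I = (\<Sum>t=1..T. l (I t) t) - Min ((\<lambda>j. \<Sum>t=1..T. l j t) ` {1..N})"

definition prob_regret_le ::
  "nat \<Rightarrow> nat \<Rightarrow> (nat \<Rightarrow> nat \<Rightarrow> real) \<Rightarrow> (nat \<Rightarrow> nat \<Rightarrow> real) \<Rightarrow> real \<Rightarrow> real \<Rightarrow> real \<Rightarrow> real" where
  "prob_regret_le N T l lam Q \<beta> B =
     measure_pmf.prob (exp3_run N (sqrt (4 / Q * ln (real N))) \<beta> l lam T)
       {I. regret N T l I \<le> B}"

lemma exp_weight_nonneg: "0 \<le> exp_weight N \<eta> L i"
  by (simp add: exp_weight_def sum_nonneg)

lemma sum_exp_weight:
  assumes "1 \<le> N"
  shows "(\<Sum>i=1..N. exp_weight N \<eta> L i) = 1"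
proof -
  have "(\<Sum>k=1..N. exp (- \<eta> * L k)) > 0"
    using assms by (intro sum_pos) auto
  then show ?thesis
    unfolding exp_weight_def by (subst sum_divide_distrib [symmetric]) simp
qed

text \<open>The argument of \<open>embed_pmf\<close> above is a probability mass function.\<close>

lemma pmf_exp3_draw:
  assumes "1 \<le> N"
  shows "pmf (exp3_draw N \<eta> L) i = (if i \<in> {1..N} then exp_weight N \<eta> L i else 0)"
  unfolding exp3_draw_def
proof (rule pmf_embed_pmf)
  show "0 \<le> (if i \<in> {1..N} then exp_weight N \<eta> L i else 0)" for i
    by (simp add: exp_weight_nonneg)
  have "(\<integral>\<^sup>+ i. ennreal (if i \<in> {1..N} then exp_weight N \<eta> L i else 0) \<partial>count_space UNIV)
      = (\<Sum>i\<in>{1..N}. ennreal (if i \<in> {1..N} then exp_weight N \<eta> L i else 0))"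
    by (rule nn_integral_count_space') auto
  also have "\<dots> = (\<Sum>i\<in>{1..N}. ennreal (exp_weight N \<eta> L i))"
    by (rule sum.cong) auto
  also have "\<dots> = ennreal (\<Sum>i=1..N. exp_weight N \<eta> L i)"
    by (simp add: sum_ennreal exp_weight_nonneg)
  finally show "(\<integral>\<^sup>+ i. ennreal (if i \<in> {1..N} then exp_weight N \<eta> L i else 0) \<partial>count_space UNIV) = 1"
    using sum_exp_weight [OF assms] by simp
qed

lemma exp3_draw_first:
  assumes "1 \<le> N"
  shows "exp3_draw N \<eta> (exp3_est N \<eta> \<beta> l lam I 0) = pmf_of_set {1..N}"
  using assms by (intro pmf_eqI) (auto simp: pmf_exp3_draw exp_weight_def)

end

theory Submission
  imports Defs
begin

text \<open>
  Fix a best expert \<open>j\<close>; it is deterministic since the losses are fixed in advance. The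
  exponential-weights analysis bounds the regret by
  \<open>ln N / \<eta> + \<eta> q(\<lambda>)\<close> plus one term per round, collecting the second-order cost of
  the estimates, the loss hidden by the shrinkage, the fluctuation of \<open>\<lambda>\<close> at the drawn expert, and
  the overestimation of \<open>s\<close> at \<open>j\<close>. Scaled by \<open>\<beta>\<close>, each of these has an exponential
  moment bounded by that of \<open>O(\<beta> (\<beta> + \<eta>) (\<parallel>s\<parallel>\<^sup>2 + d(\<lambda>)\<^sup>2))\<close>, so the exponential of
  \<open>\<beta>/4\<close> times their sum is controlled by a supermartingale, and a single application of Markov's
  inequality gives regret at most
  \<open>ln N / \<eta> + 6 \<eta> Q + 12 \<beta> Q + (4 / \<beta>) ln (1 / \<delta>)\<close> with probability at least
  \<open>1 - \<delta>\<close>. In (iii), if the minimum defining \<open>\<beta>\<close> is \<open>1\<close> then \<open>T\<close> itself is below the claimed bound.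
\<close>

subsection \<open>Elementary inequalities\<close>

text \<open>Since \<open>exp x\<close> dominates its quadratic Taylor polynomial, it suffices that
  the product of the two quadratics, \<open>1 + x ^ 4 / 4\<close>, is at least
  \<open>1\<close>.\<close>

lemma exp_minus_le_quadratic:
  fixes x :: real
  assumes "0 \<le> x"
  shows "exp (- x) \<le> 1 - x + x\<^sup>2 / 2"
proof -
  have pos: "0 < 1 - x + x\<^sup>2 / 2"
    using zero_le_power2 [of "x - 1"] by (simp add: power2_eq_square algebra_simps)
  have "1 \<le> (1 - x + x\<^sup>2 / 2) * (1 + x + x\<^sup>2 / 2)"
    using assms by (simp add: power2_eq_square algebra_simps)
  also have "\<dots> \<le> (1 - x + x\<^sup>2 / 2) * exp x"
    using pos exp_lower_Taylor_quadratic [OF assms] by (intro mult_left_mono) auto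
  finally show ?thesis
    by (simp add: exp_minus field_simps)
qed

text \<open>
  The truncation \<open>min 1 a\<close> keeps the second-order cost of a round below the slack of the
  drawn expert, hence below \<open>1 / \<beta>\<close>; with \<open>a\<^sup>2\<close> instead, the deviations in part (ii)
  would be too large by a factor \<open>sqrt (ln N)\<close>.
\<close>

lemma exp_minus_add_le:
  fixes a b :: real
  assumes "0 \<le> a" "0 \<le> b"
  shows "exp (- (a + b)) \<le> 1 - (a + b) + a * min 1 a + b\<^sup>2"
proof -
  \<comment> \<open>Arguments are doubled because \<open>exp (- (a + b))\<close> is at most the mean
    of \<open>exp (- (2 * a))\<close> and \<open>exp (- (2 * b))\<close>; this separates
    \<open>a\<close> from \<open>b\<close>.\<close>
  have a: "exp (- (2 * a)) \<le> 1 - 2 * a + 2 * (a * min 1 a)"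
  proof (cases "a \<le> 1")
    case True
    then show ?thesis
      using exp_minus_le_quadratic [of "2 * a"] assms by (simp add: power2_eq_square)
  next
    case False
    then have "exp (- (2 * a)) \<le> 1" by simp
    with False show ?thesis by simp
  qed
  have b: "exp (- (2 * b)) \<le> 1 - 2 * b + 2 * b\<^sup>2"
    using exp_minus_le_quadratic [of "2 * b"] assms by (simp add: power2_eq_square)
  have "2 * (exp (- a) * exp (- b)) \<le> (exp (- a))\<^sup>2 + (exp (- b))\<^sup>2"
    using zero_le_power2 [of "exp (- a) - exp (- b)"] by (simp add: power2_eq_square algebra_simps)
  then have "2 * exp (- (a + b)) \<le> exp (- (2 * a)) + exp (- (2 * b))"
    by (simp add: exp_add [symmetric] power2_eq_square)
  with a b show ?thesis by simp
qed

subsection \<open>The shrunk slack estimate\<close>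

text \<open>
  With \<open>y = \<beta> s\<close> the denominator of the shrinkage is the convex combination
  \<open>p (1 - y) + y (1 - p)\<close>, symmetric in \<open>p\<close> and \<open>y\<close>.
\<close>

lemma shrinkage_denominator:
  fixes p y :: real
  assumes "0 < p" "p < 1" "0 \<le> y" "y \<le> 1"
  defines "D \<equiv> p * (1 - y) + y * (1 - p)"
  shows "0 < D" "p * (1 - p) \<le> D" "y * (1 - y) \<le> D"
proof -
  have "p * (1 - y) + y * (1 - p) - p * (1 - p) = p * (p * (1 - y)) + y * ((1 - p) * (1 - p))"
    by (simp add: algebra_simps)
  also have "\<dots> \<ge> 0"
    using assms by simp
  finally show "p * (1 - p) \<le> D" by (simp add: D_def)
  then show "0 < D"
    using assms by (smt (verit) mult_pos_pos)
  have "p * (1 - y) + y * (1 - p) - y * (1 - y) = y * (y * (1 - p)) + p * ((1 - y) * (1 - y))"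
    by (simp add: algebra_simps)
  also have "\<dots> \<ge> 0"
    using assms by simp
  finally show "y * (1 - y) \<le> D" by (simp add: D_def)
qed

text \<open>The amount \<open>exp3_est\<close> adds at the drawn expert on top of the lower bound:
  an importance-weighted estimate of \<open>s\<close>, biased downwards by the factor
  \<open>1 - shrinkage \<beta> s p\<close>.\<close>

definition slack_est :: "real \<Rightarrow> real \<Rightarrow> real \<Rightarrow> real" where
  "slack_est \<beta> s p = s * (1 - shrinkage \<beta> s p) / p"

context
  fixes \<beta> s p :: real
  assumes p: "0 < p" "p < 1" and s: "0 \<le> s" "\<beta> * s \<le> 1" and \<beta>: "0 < \<beta>"
begin

lemma one_minus_shrinkage:
  "1 - shrinkage \<beta> s p
    = p * (1 - \<beta> * s) / (p * (1 - \<beta> * s) + \<beta> * s * (1 - p))"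
  using shrinkage_denominator(1) [of p "\<beta> * s"] p s \<beta> by (simp add: shrinkage_def field_simps)

lemma shrinkage_nonneg: "0 \<le> shrinkage \<beta> s p"
  using shrinkage_denominator(1) [of p "\<beta> * s"] p s \<beta> by (simp add: shrinkage_def)

lemma shrinkage_le_1: "shrinkage \<beta> s p \<le> 1"
proof -
  have "0 \<le> 1 - shrinkage \<beta> s p"
    unfolding one_minus_shrinkage
    using shrinkage_denominator(1) [of p "\<beta> * s"] p s \<beta> by simp
  then show ?thesis by simp
qed

text \<open>The factor \<open>p * (1 - p)\<close> of the numerator is at most the denominator.
  Averaged over the draw, the loss hidden by the shrinkage is thus of order
  \<open>\<beta> * s\<^sup>2\<close>, free of \<open>1 / p\<close>.\<close>

lemma mult_shrinkage_le: "p * shrinkage \<beta> s p \<le> \<beta> * s"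
proof -
  let ?D = "p * (1 - \<beta> * s) + \<beta> * s * (1 - p)"
  have "p * shrinkage \<beta> s p = \<beta> * s * (p * (1 - p)) / ?D"
    by (simp add: shrinkage_def mult_ac)
  also have "\<dots> \<le> \<beta> * s * ?D / ?D"
    using shrinkage_denominator [of p "\<beta> * s"] p s \<beta>
    by (intro divide_right_mono mult_left_mono) auto
  also have "\<dots> = \<beta> * s"
    using shrinkage_denominator(1) [of p "\<beta> * s"] p s \<beta> by simp
  finally show ?thesis .
qed

lemma slack_est_nonneg: "0 \<le> slack_est \<beta> s p"
  using shrinkage_le_1 p s by (simp add: slack_est_def)

lemma mult_slack_est: "p * slack_est \<beta> s p = s * (1 - shrinkage \<beta> s p)"
  using p by (simp add: slack_est_def)

lemma mult_slack_est_le: "p * slack_est \<beta> s p \<le> s"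
  using mult_left_mono [of "1 - shrinkage \<beta> s p" 1 s] shrinkage_nonneg s
  by (simp add: mult_slack_est)

lemma slack_est_eq:
  "\<beta> * slack_est \<beta> s p
    = \<beta> * s * (1 - \<beta> * s) / (p * (1 - \<beta> * s) + \<beta> * s * (1 - p))"
  using p by (simp add: slack_est_def one_minus_shrinkage)

text \<open>This is what the shrinkage buys: \<open>s / p\<close> is unbounded for small
  \<open>p\<close>, whereas here the numerator \<open>y * (1 - y)\<close>, with
  \<open>y = \<beta> * s\<close>, is at most the denominator.\<close>

lemma slack_est_le: "\<beta> * slack_est \<beta> s p \<le> 1"
  unfolding slack_est_eq
  using shrinkage_denominator [of p "\<beta> * s"] p s \<beta> by (simp add: divide_le_eq_1)

text \<open>Controls the overestimation at a fixed expert: beyond the target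
  \<open>\<beta> * s\<close> the exponent is of second order, with no factor \<open>1 / p\<close>.
  As \<open>\<beta>\<close> times the estimate lies in \<open>[0, 1]\<close>, a quadratic bound on
  \<open>exp\<close> reduces the claim to two moments.\<close>

lemma slack_est_mgf: "p * exp (\<beta> * slack_est \<beta> s p) + (1 - p) \<le> exp (\<beta> * s + 2 * (\<beta> * s)\<^sup>2)"
proof -
  define y where "y = \<beta> * s"
  define D where "D = p * (1 - y) + y * (1 - p)"
  define v where "v = \<beta> * slack_est \<beta> s p"
  have y: "0 \<le> y" "y \<le> 1" using s \<beta> by (auto simp: y_def)
  have D: "0 < D" using shrinkage_denominator(1) [of p y] p y by (simp add: D_def)
  have v: "v = y * (1 - y) / D" by (simp add: v_def slack_est_eq D_def y_def)
  have v01: "0 \<le> v" "v \<le> 1"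
    using slack_est_nonneg slack_est_le \<beta> by (auto simp: v_def)
  \<comment> \<open>This is \<open>p * v + p * v\<^sup>2 \<le> y + 2 * y\<^sup>2\<close> with
    denominators cleared and the factor \<open>y\<^sup>2\<close> split off. For
    \<open>p \<le> 1/2\<close> it rests on \<open>p \<le> D\<close>, otherwise on
    \<open>p * (1 - y) \<le> D\<close> and \<open>1 \<le> 2 * p\<close>.\<close>
  have key: "p * (1 - y)\<^sup>2 \<le> (1 - p) * D + 2 * D\<^sup>2"
  proof (cases "p \<le> 1/2")
    case True
    have "0 \<le> y * (1 - 2 * p)" using True y by simp
    then have "p \<le> D" by (simp add: D_def algebra_simps)
    then have "(1 - p) * p \<le> (1 - p) * D" "p\<^sup>2 \<le> D\<^sup>2"
      using p by (auto intro!: mult_left_mono power_mono)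
    moreover have "p * (1 - y)\<^sup>2 \<le> p * 1"
      using p y by (intro mult_left_mono) (auto intro!: power_le_one)
    moreover have "(1 - p) * p + p\<^sup>2 = p" by (simp add: power2_eq_square algebra_simps)
    ultimately show ?thesis using zero_le_power2 [of D] by linarith
  next
    case False
    have "p * (1 - y) \<le> D" using p y by (simp add: D_def)
    then have "(p * (1 - y))\<^sup>2 \<le> D\<^sup>2" using p y by (intro power_mono) auto
    moreover have "p * (1 - y)\<^sup>2 * 1 \<le> p * (1 - y)\<^sup>2 * (2 * p)"
      using False p by (intro mult_left_mono) auto
    moreover have "0 \<le> (1 - p) * D" using p D by simp
    ultimately show ?thesis by (simp add: power2_eq_square algebra_simps)
  qed
  have "y + 2 * y\<^sup>2 - (p * v + p * v\<^sup>2) = y\<^sup>2 * ((1 - p) * D + 2 * D\<^sup>2 - p * (1 - y)\<^sup>2) / D\<^sup>2"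
  proof -
    \<comment> \<open>The second factor \<open>y\<close> appears because
      \<open>D - p * (1 - y) = y * (1 - p)\<close>.\<close>
    have "(y + 2 * y\<^sup>2) * D\<^sup>2 - (p * (y * (1 - y)) * D + p * (y * (1 - y))\<^sup>2)
        = y\<^sup>2 * ((1 - p) * D + 2 * D\<^sup>2 - p * (1 - y)\<^sup>2)"
      unfolding D_def power2_eq_square by algebra
    moreover have "y + 2 * y\<^sup>2 - (p * (w / D) + p * (w / D)\<^sup>2)
        = ((y + 2 * y\<^sup>2) * D\<^sup>2 - (p * w * D + p * w\<^sup>2)) / D\<^sup>2" for w
      using D by (simp add: field_simps power2_eq_square)
    ultimately show ?thesis by (simp add: v)
  qed
  also have "\<dots> \<ge> 0"
    using key by simp
  finally have "p * v + p * v\<^sup>2 \<le> y + 2 * y\<^sup>2" by simp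
  moreover have "p * exp v \<le> p * (1 + v + v\<^sup>2)"
    using exp_bound [of v] v01 p by (intro mult_left_mono) auto
  ultimately have "p * exp v + (1 - p) \<le> 1 + (y + 2 * y\<^sup>2)"
    by (simp add: algebra_simps)
  also have "\<dots> \<le> exp (y + 2 * y\<^sup>2)" by (rule exp_ge_add_one_self)
  finally show ?thesis by (simp add: v_def y_def)
qed

end

section \<open>Exponential moments of bounded variables\<close>

text \<open>On the unit interval \<open>exp (V i) \<le> 1 + 2 * V i\<close>, so the moment is
  governed by the mean alone. This suits nonnegative terms whose mean is already of second
  order.\<close>

lemma sum_exp_unit_le:
  fixes p V :: "'a \<Rightarrow> real"
  assumes "finite A" "\<And>i. i \<in> A \<Longrightarrow> 0 \<le> p i" "sum p A = 1"
    and V: "\<And>i. i \<in> A \<Longrightarrow> 0 \<le> V i" "\<And>i. i \<in> A \<Longrightarrow> V i \<le> 1" and v: "(\<Sum>i\<in>A. p i * V i) \<le> v"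
  shows "(\<Sum>i\<in>A. p i * exp (V i)) \<le> exp (2 * v)"
proof -
  have "exp (V i) \<le> 1 + 2 * V i" if "i \<in> A" for i
  proof -
    have "V i * V i \<le> V i * 1" using V that by (intro mult_left_mono) auto
    then show ?thesis using exp_bound [of "V i"] V that by (simp add: power2_eq_square)
  qed
  then have "(\<Sum>i\<in>A. p i * exp (V i)) \<le> (\<Sum>i\<in>A. p i * (1 + 2 * V i))"
    using assms by (intro sum_mono mult_left_mono) auto
  also have "\<dots> = 1 + 2 * (\<Sum>i\<in>A. p i * V i)"
    using assms by (simp add: algebra_simps sum.distrib sum_distrib_left)
  also have "\<dots> \<le> 1 + 2 * v" using v by simp
  also have "\<dots> \<le> exp (2 * v)" by (rule exp_ge_add_one_self)
  finally show ?thesis .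
qed

text \<open>Meant for the lower bounds at the drawn expert: only their range \<open>b - a\<close>
  enters, not their size.\<close>

lemma Hoeffdings_lemma_pmf:
  fixes D :: "'a pmf" and f :: "'a \<Rightarrow> real"
  assumes A: "finite A" "set_pmf D \<subseteq> A" and f: "\<And>i. i \<in> A \<Longrightarrow> f i \<in> {a..b}" and l: "0 < l"
  shows "(\<Sum>i\<in>A. pmf D i * exp (l * (f i - (\<Sum>k\<in>A. pmf D k * f k)))) \<le> exp (l\<^sup>2 * (b - a)\<^sup>2 / 8)"
proof -
  interpret interval_bounded_random_variable "measure_pmf D" f a b
    by unfold_locales (use A f in \<open>auto simp: AE_measure_pmf_iff\<close>)
  have E: "measure_pmf.expectation D f = (\<Sum>k\<in>A. pmf D k * f k)"
    using integral_measure_pmf_real [of A D f] A by (auto simp: mult.commute)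
  have "ennreal (\<Sum>i\<in>A. pmf D i * exp (l * (f i - (\<Sum>k\<in>A. pmf D k * f k))))
      = (\<integral>\<^sup>+i. exp (l * (f i - measure_pmf.expectation D f)) \<partial>measure_pmf D)"
    using A by (subst nn_integral_measure_pmf_support [of A])
      (auto simp: E ennreal_mult' [symmetric] sum_ennreal mult.commute)
  also have "\<dots> \<le> ennreal (exp (l\<^sup>2 * (b - a)\<^sup>2 / 8))"
    using Hoeffdings_lemma_nn_integral [OF l] by simp
  finally show ?thesis by (simp add: ennreal_le_iff)
qed

text \<open>Convexity of \<open>exp\<close>, as the midpoint inequality used twice. It lets four
  dependent terms be bounded separately; the price is the factor \<open>1/4\<close> in the exponent,
  hence \<open>\<beta> / 4\<close> below.\<close>

lemma exp_mean4_le: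
  fixes a b c d :: real
  shows "exp ((a + b + c + d) / 4) \<le> (exp a + exp b + exp c + exp d) / 4"
proof -
  have mid: "exp ((x + y) / 2) \<le> (exp x + exp y) / 2" for x y :: real
  proof -
    have "0 \<le> (exp (x / 2) - exp (y / 2))\<^sup>2" by simp
    also have "\<dots> = exp x + exp y - 2 * exp ((x + y) / 2)"
      by (simp add: power2_diff exp_double [symmetric] exp_add [symmetric] add_divide_distrib)
    finally show ?thesis by simp
  qed
  have "exp ((a + b + c + d) / 4) = exp (((a + b) / 2 + (c + d) / 2) / 2)"
    by (simp add: field_simps)
  also have "\<dots> \<le> (exp ((a + b) / 2) + exp ((c + d) / 2)) / 2" by (rule mid)
  also have "\<dots> \<le> ((exp a + exp b) / 2 + (exp c + exp d) / 2) / 2"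
    using mid [of a b] mid [of c d] by (intro divide_right_mono add_mono) auto
  finally show ?thesis by (simp add: field_simps)
qed

subsection \<open>Exponential weights and the excess of a round\<close>

text \<open>Here \<open>i\<close> is the drawn expert and \<open>j\<close> the comparator. The lower
  bound is centred because exponential weights accounts for its mean under \<open>p\<close>, whereas
  the learner pays it at \<open>i\<close>.\<close>

definition round_excess ::
  "'a set \<Rightarrow> real \<Rightarrow> real \<Rightarrow> ('a \<Rightarrow> real) \<Rightarrow> ('a \<Rightarrow> real) \<Rightarrow> ('a \<Rightarrow> real) \<Rightarrow> 'a \<Rightarrow> 'a \<Rightarrow> real" where
  "round_excess A \<eta> \<beta> p s lam j i =
     s i * min 1 (\<eta> * slack_est \<beta> (s i) (p i)) + s i * shrinkage \<beta> (s i) (p i)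
     + (lam i - (\<Sum>k\<in>A. p k * lam k)) + (slack_est \<beta> (s j) (p j) * of_bool (i = j) - s j)"

text \<open>After scaling by \<open>\<beta>\<close>, the four summands of the excess are bounded one
  by one, all by the same right-hand side, and recombined by \<open>exp_mean4_le\<close>.\<close>

lemma round_excess_mgf:
  fixes D :: "'a pmf" and s lam :: "'a \<Rightarrow> real"
  defines "p \<equiv> pmf D"
  assumes A: "finite A" "set_pmf D \<subseteq> A" "j \<in> A"
    and p: "\<And>i. i \<in> A \<Longrightarrow> 0 < p i" "\<And>i. i \<in> A \<Longrightarrow> p i < 1"
    and s: "\<And>i. i \<in> A \<Longrightarrow> 0 \<le> s i" "\<And>i. i \<in> A \<Longrightarrow> \<beta> * s i \<le> 1"
    and lam: "\<And>i. i \<in> A \<Longrightarrow> lam i \<in> {a..b}"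
    and \<beta>: "0 < \<beta>" and \<eta>: "0 \<le> \<eta>"
  shows "(\<Sum>i\<in>A. p i * exp (\<beta> / 4 * round_excess A \<eta> \<beta> p s lam j i))
    \<le> exp (2 * \<beta> * (\<beta> + \<eta>) * (\<Sum>i\<in>A. (s i)\<^sup>2) + \<beta>\<^sup>2 * (b - a)\<^sup>2)" (is "_ \<le> exp ?B")
proof -
  let ?z = "\<lambda>i. slack_est \<beta> (s i) (p i)" and ?x = "\<lambda>i. shrinkage \<beta> (s i) (p i)"
  let ?S = "\<Sum>i\<in>A. (s i)\<^sup>2"
  define E1 where "E1 i = \<beta> * (s i * min 1 (\<eta> * ?z i))" for i
  define E2 where "E2 i = \<beta> * (s i * ?x i)" for i
  define E3 where "E3 i = \<beta> * (lam i - (\<Sum>k\<in>A. p k * lam k))" for i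
  define E4 where "E4 i = \<beta> * (?z j * of_bool (i = j) - s j)" for i
  have p0: "0 \<le> p i" if "i \<in> A" for i using p that by (simp add: less_imp_le)
  have sum_p: "sum p A = 1"
    unfolding p_def using A by (intro sum_pmf_eq_1) auto
  have zpos: "0 \<le> ?z i" if "i \<in> A" for i
    using p s \<beta> that by (intro slack_est_nonneg) auto
  have xpos: "0 \<le> ?x i" "?x i \<le> 1" if "i \<in> A" for i
    using p s \<beta> that by (auto intro: shrinkage_nonneg shrinkage_le_1)
  have S: "0 \<le> ?S" "(s j)\<^sup>2 \<le> ?S"
    using A by (auto intro!: sum_nonneg member_le_sum)
  \<comment> \<open>Keeps \<open>E1\<close> and \<open>E2\<close> at most \<open>1\<close>; for
    \<open>E1\<close> the truncation by \<open>min 1\<close> supplies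
    \<open>u \<le> 1\<close>.\<close>
  have scale: "\<beta> * (s i * u) \<le> 1" if "i \<in> A" "0 \<le> u" "u \<le> 1" for i u
  proof -
    have "(\<beta> * s i) * u \<le> 1 * 1"
      using s that \<beta> by (intro mult_mono) auto
    then show ?thesis by (simp add: mult.assoc)
  qed
  have "(\<Sum>i\<in>A. p i * exp (E1 i)) \<le> exp (2 * (\<beta> * \<eta> * ?S))"
  proof (rule sum_exp_unit_le [OF A(1) p0 sum_p])
    show "0 \<le> E1 i" if "i \<in> A" for i
      using zpos s \<beta> \<eta> that by (simp add: E1_def)
    show "E1 i \<le> 1" if "i \<in> A" for i
      unfolding E1_def using zpos \<eta> that by (intro scale) auto
    \<comment> \<open>Once the truncation is dropped, \<open>p i * ?z i \<le> s i\<close> cancels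
      the factor \<open>1 / p i\<close> of the estimate.\<close>
    have "p i * E1 i \<le> \<beta> * \<eta> * (s i)\<^sup>2" if "i \<in> A" for i
    proof -
      have "p i * E1 i \<le> p i * (\<beta> * (s i * (\<eta> * ?z i)))"
        unfolding E1_def using p0 s \<beta> that by (intro mult_left_mono) auto
      also have "\<dots> = \<beta> * \<eta> * (s i * (p i * ?z i))" by simp
      also have "\<dots> \<le> \<beta> * \<eta> * (s i * s i)"
        using p s \<beta> \<eta> that by (intro mult_left_mono mult_slack_est_le) auto
      finally show ?thesis by (simp add: power2_eq_square)
    qed
    then show "(\<Sum>i\<in>A. p i * E1 i) \<le> \<beta> * \<eta> * ?S"
      by (simp add: sum_distrib_left sum_mono)
  qed
  also have "\<dots> \<le> exp ?B"
    using S \<beta> \<eta> by (simp add: algebra_simps)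
  finally have 1: "(\<Sum>i\<in>A. p i * exp (E1 i)) \<le> exp ?B" .
  have "(\<Sum>i\<in>A. p i * exp (E2 i)) \<le> exp (2 * (\<beta> * \<beta> * ?S))"
  proof (rule sum_exp_unit_le [OF A(1) p0 sum_p])
    show "0 \<le> E2 i" if "i \<in> A" for i
      using xpos s \<beta> that by (simp add: E2_def)
    show "E2 i \<le> 1" if "i \<in> A" for i
      unfolding E2_def using xpos that by (intro scale) auto
    have "p i * E2 i \<le> \<beta> * \<beta> * (s i)\<^sup>2" if "i \<in> A" for i
    proof -
      have "p i * E2 i = \<beta> * (s i * (p i * ?x i))" by (simp add: E2_def)
      also have "\<dots> \<le> \<beta> * (s i * (\<beta> * s i))"
        using p s \<beta> that by (intro mult_left_mono mult_shrinkage_le) auto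
      finally show ?thesis by (simp add: power2_eq_square mult_ac)
    qed
    then show "(\<Sum>i\<in>A. p i * E2 i) \<le> \<beta> * \<beta> * ?S"
      by (simp add: sum_distrib_left sum_mono)
  qed
  also have "\<dots> \<le> exp ?B"
    using S \<beta> \<eta> by (simp add: algebra_simps)
  finally have 2: "(\<Sum>i\<in>A. p i * exp (E2 i)) \<le> exp ?B" .
  have "(\<Sum>i\<in>A. p i * exp (E3 i)) \<le> exp (\<beta>\<^sup>2 * (b - a)\<^sup>2 / 8)"
    unfolding E3_def p_def using A lam \<beta> by (intro Hoeffdings_lemma_pmf) auto
  also have "\<dots> \<le> exp ?B"
    using S \<beta> \<eta> by (simp add: add_increasing)
  finally have 3: "(\<Sum>i\<in>A. p i * exp (E3 i)) \<le> exp ?B" .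
  \<comment> \<open>\<open>E4\<close> has one value at \<open>j\<close> and a constant value
    elsewhere, so its moment is the two-point expression of \<open>slack_est_mgf\<close>; the
    prefactor removes the first-order term.\<close>
  have "(\<Sum>i\<in>A. p i * exp (E4 i)) = exp (- (\<beta> * s j)) * (p j * exp (\<beta> * ?z j) + (1 - p j))"
  proof -
    have "(\<Sum>i\<in>A. p i * exp (E4 i)) = p j * exp (E4 j) + (\<Sum>i\<in>A - {j}. p i * exp (E4 i))"
      using A by (simp add: sum.remove)
    also have "(\<Sum>i\<in>A - {j}. p i * exp (E4 i)) = (\<Sum>i\<in>A - {j}. p i * exp (- (\<beta> * s j)))"
      by (rule sum.cong) (auto simp: E4_def)
    also have "\<dots> = (1 - p j) * exp (- (\<beta> * s j))"
      using sum_p A by (simp add: sum_distrib_right [symmetric] sum_diff1)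
    finally have "(\<Sum>i\<in>A. p i * exp (E4 i)) = p j * exp (E4 j) + (1 - p j) * exp (- (\<beta> * s j))" .
    moreover have "exp (E4 j) = exp (- (\<beta> * s j)) * exp (\<beta> * ?z j)"
      by (simp add: E4_def exp_add [symmetric] algebra_simps)
    ultimately show ?thesis by (simp only: distrib_left mult_ac)
  qed
  also have "\<dots> \<le> exp (- (\<beta> * s j)) * exp (\<beta> * s j + 2 * (\<beta> * s j)\<^sup>2)"
    using A p s \<beta> by (intro mult_left_mono slack_est_mgf) auto
  also have "\<dots> = exp (2 * \<beta>\<^sup>2 * (s j)\<^sup>2)"
    by (simp add: exp_add [symmetric] power_mult_distrib)
  also have "\<dots> \<le> exp (2 * \<beta>\<^sup>2 * ?S)"
    using S by (simp add: mult_left_mono)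
  also have "\<dots> \<le> exp ?B"
  proof -
    have "2 * \<beta> * \<beta> * ?S \<le> 2 * \<beta> * (\<beta> + \<eta>) * ?S"
      using S \<beta> \<eta> by (intro mult_right_mono mult_left_mono) auto
    moreover have "0 \<le> \<beta>\<^sup>2 * (b - a)\<^sup>2" by simp
    ultimately have "2 * \<beta>\<^sup>2 * ?S \<le> ?B"
      unfolding power2_eq_square [of \<beta>] mult.assoc [symmetric] by linarith
    then show ?thesis by simp
  qed
  finally have 4: "(\<Sum>i\<in>A. p i * exp (E4 i)) \<le> exp ?B" .
  have "\<beta> / 4 * (u + v + w + x) = (\<beta> * u + \<beta> * v + \<beta> * w + \<beta> * x) / 4" for u v w x :: real
    by (simp add: distrib_left)
  then have split: "\<beta> / 4 * round_excess A \<eta> \<beta> p s lam j i = (E1 i + E2 i + E3 i + E4 i) / 4" for i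
    by (simp only: round_excess_def E1_def E2_def E3_def E4_def)
  have "(\<Sum>i\<in>A. p i * exp (\<beta> / 4 * round_excess A \<eta> \<beta> p s lam j i))
      = (\<Sum>i\<in>A. p i * exp ((E1 i + E2 i + E3 i + E4 i) / 4))"
    by (simp only: split)
  also have "\<dots> \<le> (\<Sum>i\<in>A. p i * ((exp (E1 i) + exp (E2 i) + exp (E3 i) + exp (E4 i)) / 4))"
    using p0 by (intro sum_mono mult_left_mono exp_mean4_le) auto
  also have "\<dots> = ((\<Sum>i\<in>A. p i * exp (E1 i)) + (\<Sum>i\<in>A. p i * exp (E2 i))
      + (\<Sum>i\<in>A. p i * exp (E3 i)) + (\<Sum>i\<in>A. p i * exp (E4 i))) / 4"
    by (simp add: sum.distrib [symmetric] sum_divide_distrib distrib_left)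
  also have "\<dots> \<le> exp ?B" using 1 2 3 4 by simp
  finally show ?thesis .
qed

section \<open>Exponential weights along a fixed sequence of loss vectors\<close>

lemma exp_weight_pos: "1 \<le> N \<Longrightarrow> 0 < exp_weight N \<eta> L i"
  by (auto simp: exp_weight_def intro!: divide_pos_pos sum_pos)

text \<open>A second expert has positive weight. Strictness matters because the shrinkage
  denominator vanishes at \<open>p = 1\<close>, \<open>\<beta> * s = 1\<close>.\<close>

lemma exp_weight_less_1:
  assumes "2 \<le> N" "i \<in> {1..N}"
  shows "exp_weight N \<eta> L i < 1"
proof -
  define k where "k = (if i = 1 then 2 else 1 :: nat)"
  have k: "k \<in> {1..N}" "k \<noteq> i" using assms by (auto simp: k_def)
  have "exp_weight N \<eta> L i + exp_weight N \<eta> L k = (\<Sum>m\<in>{i, k}. exp_weight N \<eta> L m)"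
    using k by simp
  also have "\<dots> \<le> (\<Sum>m=1..N. exp_weight N \<eta> L m)"
    using k assms by (intro sum_mono2) (auto simp: exp_weight_nonneg)
  also have "\<dots> = 1" using assms by (intro sum_exp_weight) simp
  finally show ?thesis using exp_weight_pos [of N \<eta> L k] assms by simp
qed

text \<open>Potential argument for the total weight \<open>W t\<close>, valid for loss vectors of
  either sign. The second-order cost \<open>r\<close> of a round is left open and supplied through
  \<open>exp_weights_step\<close>.\<close>

lemma exp_weights_regret:
  fixes L c :: "nat \<Rightarrow> nat \<Rightarrow> real"
  assumes N: "1 \<le> N" and \<eta>: "0 < \<eta>" and j: "j \<in> {1..N}"
    and L0: "\<And>i. L 0 i = 0" and LS: "\<And>t i. L (Suc t) i = L t i + c t i"
  defines "p \<equiv> \<lambda>t. exp_weight N \<eta> (L t)"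
  assumes step: "\<And>t. t < T \<Longrightarrow> (\<Sum>i=1..N. p t i * exp (- \<eta> * c t i))
      \<le> exp (- \<eta> * (\<Sum>i=1..N. p t i * c t i) + \<eta> * r t)"
  shows "(\<Sum>t<T. \<Sum>i=1..N. p t i * c t i) - L T j \<le> ln N / \<eta> + (\<Sum>t<T. r t)"
proof -
  define W where "W t = (\<Sum>i=1..N. exp (- \<eta> * L t i))" for t
  have W_pos: "0 < W t" for t
    using N by (auto simp: W_def intro!: sum_pos)
  have W_Suc: "W (Suc t) = W t * (\<Sum>i=1..N. p t i * exp (- \<eta> * c t i))" for t
  proof -
    have "p t i = exp (- \<eta> * L t i) / W t" for i
      by (simp add: p_def exp_weight_def W_def)
    then have "W t * (p t i * exp (- \<eta> * c t i)) = exp (- \<eta> * L (Suc t) i)" for i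
      using W_pos [of t] by (simp add: LS exp_add [symmetric] algebra_simps)
    then show ?thesis by (simp add: W_def sum_distrib_left)
  qed
  define K where "K t = (\<Sum>u<t. (\<Sum>i=1..N. p u i * c u i) - r u)" for t
  have W_le: "t \<le> T \<Longrightarrow> W t \<le> N * exp (- \<eta> * K t)" for t
  proof (induction t)
    case 0
    show ?case by (simp add: W_def L0 K_def)
  next
    case (Suc t)
    have "W (Suc t) \<le> (N * exp (- \<eta> * K t)) * exp (- \<eta> * (\<Sum>i=1..N. p t i * c t i) + \<eta> * r t)"
      unfolding W_Suc using Suc step [of t] N
      by (intro mult_mono) (auto simp: p_def exp_weight_nonneg intro!: sum_nonneg)
    also have "\<dots> = N * exp (- \<eta> * K (Suc t))"
      by (simp add: K_def mult.assoc exp_add [symmetric] algebra_simps)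
    finally show ?case .
  qed
  \<comment> \<open>A single summand bounds the total weight from below, which brings in the
    comparator.\<close>
  have "exp (- \<eta> * L T j) \<le> W T"
    unfolding W_def using j by (intro member_le_sum) auto
  also have "\<dots> \<le> N * exp (- \<eta> * K T)" by (rule W_le) simp
  also have "\<dots> = exp (ln N - \<eta> * K T)"
    using N by (simp add: exp_diff exp_minus field_simps)
  finally have "\<eta> * (K T - L T j) \<le> ln N"
    by (simp add: algebra_simps)
  then have "K T - L T j \<le> ln N / \<eta>"
    using \<eta> by (simp add: field_simps)
  then show ?thesis by (simp add: K_def sum_subtractf)
qed

text \<open>The loss vector is a spike \<open>z\<close> at \<open>k\<close> on top of
  \<open>lam\<close>. Shifting by \<open>a\<close> makes both parts nonnegative, so
  \<open>exp_minus_add_le\<close> applies and \<open>lam\<close> costs only its range.\<close>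

lemma exp_weights_step:
  fixes p lam :: "'a \<Rightarrow> real"
  assumes A: "finite A" "\<And>i. i \<in> A \<Longrightarrow> 0 \<le> p i" "sum p A = 1" "k \<in> A"
    and z: "0 \<le> z" "p k * z \<le> s" and lam: "\<And>i. i \<in> A \<Longrightarrow> lam i \<in> {a..b}" and \<eta>: "0 \<le> \<eta>"
  defines "c \<equiv> \<lambda>i. z * of_bool (k = i) + lam i"
  shows "(\<Sum>i\<in>A. p i * exp (- \<eta> * c i))
    \<le> exp (- \<eta> * (\<Sum>i\<in>A. p i * c i) + \<eta> * (s * min 1 (\<eta> * z) + \<eta> * (b - a)\<^sup>2))"
proof -
  let ?u = "\<lambda>i. \<eta> * z * of_bool (k = i)"
  let ?m = "\<eta> * z * min 1 (\<eta> * z)"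
  have term_le: "exp (- \<eta> * c i) \<le>
      exp (- \<eta> * a) * ((1 + \<eta> * a + (\<eta> * (b - a))\<^sup>2) - \<eta> * c i + ?m * of_bool (k = i))"
    if i: "i \<in> A" for i
  proof -
    have "exp (- \<eta> * c i) = exp (- \<eta> * a) * exp (- (?u i + \<eta> * (lam i - a)))"
      by (simp add: c_def exp_add [symmetric] algebra_simps)
    moreover have "exp (- (?u i + \<eta> * (lam i - a))) \<le>
        1 - (?u i + \<eta> * (lam i - a)) + ?u i * min 1 (?u i) + (\<eta> * (lam i - a))\<^sup>2"
      using z \<eta> lam [OF i] by (intro exp_minus_add_le) auto
    moreover have "(\<eta> * (lam i - a))\<^sup>2 \<le> (\<eta> * (b - a))\<^sup>2"
      using \<eta> lam [OF i] by (intro power_mono mult_left_mono) auto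
    moreover have "?u i * min 1 (?u i) = ?m * of_bool (k = i)"
      by simp
    moreover have "?u i + \<eta> * (lam i - a) = \<eta> * c i - \<eta> * a"
      by (simp add: c_def algebra_simps)
    ultimately have "exp (- (?u i + \<eta> * (lam i - a))) \<le>
        (1 + \<eta> * a + (\<eta> * (b - a))\<^sup>2) - \<eta> * c i + ?m * of_bool (k = i)"
      by linarith
    then show ?thesis
      unfolding \<open>exp (- \<eta> * c i) = _\<close> by (intro mult_left_mono) auto
  qed
  have "(\<Sum>i\<in>A. p i * exp (- \<eta> * c i))
      \<le> (\<Sum>i\<in>A. p i * (exp (- \<eta> * a) * ((1 + \<eta> * a + (\<eta> * (b - a))\<^sup>2) - \<eta> * c i + ?m * of_bool (k = i))))"
    using A term_le by (intro sum_mono mult_left_mono) auto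
  also have "\<dots> = (\<Sum>i\<in>A. exp (- \<eta> * a) *
      (p i * (1 + \<eta> * a + (\<eta> * (b - a))\<^sup>2) - \<eta> * (p i * c i) + (if k = i then p i * ?m else 0)))"
    by (intro sum.cong) (auto simp: algebra_simps)
  also have "\<dots> = exp (- \<eta> * a) *
      ((1 + \<eta> * a + (\<eta> * (b - a))\<^sup>2) - \<eta> * (\<Sum>i\<in>A. p i * c i) + p k * ?m)"
    using A by (simp only: sum_distrib_left [symmetric] sum_distrib_right [symmetric]
        sum.distrib sum_subtractf sum.delta' if_True mult_1_left)
  \<comment> \<open>The weight \<open>p k\<close> absorbs the size of the spike, leaving a cost at
    most linear in \<open>s\<close>.\<close>
  also have "p k * ?m = p k * z * (\<eta> * min 1 (\<eta> * z))" by simp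
  also have "\<dots> \<le> s * (\<eta> * min 1 (\<eta> * z))"
    using z \<eta> by (intro mult_right_mono) auto
  \<comment> \<open>Written as \<open>1 + w\<close> so that \<open>1 + w \<le> exp w\<close>
    applies; the summand \<open>\<eta> * a\<close> of \<open>w\<close> then cancels the
    prefactor.\<close>
  also have "(1 + \<eta> * a + (\<eta> * (b - a))\<^sup>2) - \<eta> * (\<Sum>i\<in>A. p i * c i) + s * (\<eta> * min 1 (\<eta> * z))
      = 1 + (\<eta> * a - \<eta> * (\<Sum>i\<in>A. p i * c i) + \<eta> * (s * min 1 (\<eta> * z) + \<eta> * (b - a)\<^sup>2))"
    by (simp add: algebra_simps power2_eq_square)
  also have "exp (- \<eta> * a) * \<dots> \<le> exp (- \<eta> * a) *
      exp (\<eta> * a - \<eta> * (\<Sum>i\<in>A. p i * c i) + \<eta> * (s * min 1 (\<eta> * z) + \<eta> * (b - a)\<^sup>2))"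
    by (intro mult_left_mono exp_ge_add_one_self) auto
  also have "\<dots> = exp (- \<eta> * (\<Sum>i\<in>A. p i * c i) + \<eta> * (s * min 1 (\<eta> * z) + \<eta> * (b - a)\<^sup>2))"
    by (simp add: exp_add [symmetric])
  finally show ?thesis by simp
qed

subsection \<open>Moments along a run\<close>

text \<open>Estimates do not anticipate: this is what lets the last draw be integrated out given the
  past.\<close>

lemma exp3_est_fun_upd:
  "t \<le> u \<Longrightarrow> exp3_est N \<eta> \<beta> l lam (I(Suc u := i)) t = exp3_est N \<eta> \<beta> l lam I t"
  by (induction t) auto

lemma set_pmf_exp3_draw: "1 \<le> N \<Longrightarrow> set_pmf (exp3_draw N \<eta> L) \<subseteq> {1..N}"
  by (auto simp: set_pmf_eq pmf_exp3_draw split: if_splits)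

lemma exp3_run_range:
  assumes "1 \<le> N" "I \<in> set_pmf (exp3_run N \<eta> \<beta> l lam T)" "t < T"
  shows "I (Suc t) \<in> {1..N}"
  using assms(2,3)
proof (induction T arbitrary: I)
  case (Suc T)
  then obtain I' i where I': "I' \<in> set_pmf (exp3_run N \<eta> \<beta> l lam T)"
    and i: "i \<in> set_pmf (exp3_draw N \<eta> (exp3_est N \<eta> \<beta> l lam I' T))" and I: "I = I'(Suc T := i)"
    by auto
  show ?case
  proof (cases "t = T")
    case True
    then show ?thesis using I subsetD [OF set_pmf_exp3_draw [OF assms(1)] i] by simp
  next
    case False
    then show ?thesis using Suc.IH [OF I'] Suc.prems I by simp
  qed
qed simp

text \<open>Supermartingale argument by induction on the rounds. The one-round bound holds for every
  estimate vector \<open>L\<close>, hence conditionally on any past, so the last factor contributes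
  at most \<open>exp (b T)\<close>.\<close>

lemma nn_integral_exp3_run_le:
  fixes F :: "(nat \<Rightarrow> real) \<Rightarrow> nat \<Rightarrow> nat \<Rightarrow> real"
  assumes N: "1 \<le> N"
    and F: "\<And>L t. t < T \<Longrightarrow> (\<Sum>i=1..N. exp_weight N \<eta> L i * exp (F L t i)) \<le> exp (b t)"
  shows "(\<integral>\<^sup>+I. ennreal (exp (\<Sum>t<T. F (exp3_est N \<eta> \<beta> l lam I t) t (I (Suc t))))
    \<partial>measure_pmf (exp3_run N \<eta> \<beta> l lam T)) \<le> ennreal (exp (\<Sum>t<T. b t))"
  using F
proof (induction T)
  case (Suc T)
  let ?L = "exp3_est N \<eta> \<beta> l lam"
  let ?S = "\<lambda>I. \<Sum>t<T. F (?L I t) t (I (Suc t))"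
  have draw: "(\<integral>\<^sup>+i. ennreal (exp (F L T i)) \<partial>measure_pmf (exp3_draw N \<eta> L)) \<le> ennreal (exp (b T))" for L
  proof -
    have "(\<integral>\<^sup>+i. ennreal (exp (F L T i)) \<partial>measure_pmf (exp3_draw N \<eta> L))
        = (\<Sum>i=1..N. ennreal (exp (F L T i)) * pmf (exp3_draw N \<eta> L) i)"
      using subsetD [OF set_pmf_exp3_draw [OF N]] by (intro nn_integral_measure_pmf_support) fastforce+
    also have "\<dots> = (\<Sum>i=1..N. ennreal (exp_weight N \<eta> L i * exp (F L T i)))"
      by (intro sum.cong) (auto simp: pmf_exp3_draw [OF N] ennreal_mult' [symmetric] mult.commute
          exp_weight_nonneg)
    also have "\<dots> = ennreal (\<Sum>i=1..N. exp_weight N \<eta> L i * exp (F L T i))"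
      by (simp add: sum_ennreal exp_weight_nonneg)
    also have "\<dots> \<le> ennreal (exp (b T))"
      using Suc.prems by (simp add: ennreal_leI)
    finally show ?thesis .
  qed
  have "(\<integral>\<^sup>+I. ennreal (exp (\<Sum>t<Suc T. F (?L I t) t (I (Suc t))))
      \<partial>measure_pmf (exp3_run N \<eta> \<beta> l lam (Suc T)))
    = (\<integral>\<^sup>+I. \<integral>\<^sup>+i. ennreal (exp (?S I)) * ennreal (exp (F (?L I T) T i))
        \<partial>measure_pmf (exp3_draw N \<eta> (?L I T)) \<partial>measure_pmf (exp3_run N \<eta> \<beta> l lam T))"
    by (simp add: exp3_est_fun_upd exp_add ennreal_mult)
  also have "\<dots> = (\<integral>\<^sup>+I. ennreal (exp (?S I)) * (\<integral>\<^sup>+i. ennreal (exp (F (?L I T) T i))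
        \<partial>measure_pmf (exp3_draw N \<eta> (?L I T))) \<partial>measure_pmf (exp3_run N \<eta> \<beta> l lam T))"
    by (simp add: nn_integral_cmult)
  also have "\<dots> \<le> (\<integral>\<^sup>+I. ennreal (exp (?S I)) * ennreal (exp (b T))
      \<partial>measure_pmf (exp3_run N \<eta> \<beta> l lam T))"
    using draw by (intro nn_integral_mono mult_left_mono) auto
  also have "\<dots> \<le> ennreal (exp (\<Sum>t<T. b t)) * ennreal (exp (b T))"
    using Suc by (simp add: nn_integral_multc mult_right_mono)
  also have "\<dots> = ennreal (exp (\<Sum>t<Suc T. b t))"
    by (simp add: exp_add ennreal_mult)
  finally show ?case .
qed simp

lemma pmf_exp_Markov:
  fixes P :: "'a pmf" and S :: "'a \<Rightarrow> real"
  assumes "(\<integral>\<^sup>+x. ennreal (exp (S x)) \<partial>measure_pmf P) \<le> ennreal (exp b)" and \<delta>: "0 < \<delta>"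
  shows "1 - \<delta> \<le> measure_pmf.prob P {x. S x \<le> b + ln (1 / \<delta>)}"
proof -
  let ?bad = "{x. b + ln (1 / \<delta>) < S x}"
  have "emeasure P ?bad = (\<integral>\<^sup>+x. indicator ?bad x \<partial>measure_pmf P)"
    by simp
  also have "\<dots> \<le> (\<integral>\<^sup>+x. ennreal (\<delta> * exp (- b)) * ennreal (exp (S x)) \<partial>measure_pmf P)"
  proof (rule nn_integral_mono)
    fix x
    show "indicator ?bad x \<le> ennreal (\<delta> * exp (- b)) * ennreal (exp (S x))"
    proof (cases "x \<in> ?bad")
      case True
      \<comment> \<open>The constant is normalised to make the majorant of the indicator equal
        \<open>1\<close> at the threshold.\<close>
      have "\<delta> * exp (- b) * exp (b + ln (1 / \<delta>)) = 1"
        using \<delta> by (simp add: exp_add exp_minus field_simps)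
      moreover have "\<delta> * exp (- b) * exp (b + ln (1 / \<delta>)) \<le> \<delta> * exp (- b) * exp (S x)"
        using True \<delta> by (intro mult_left_mono) auto
      ultimately show ?thesis
        using True \<delta> by (simp add: ennreal_mult' [symmetric] ennreal_ge_1)
    qed simp
  qed
  also have "\<dots> = ennreal (\<delta> * exp (- b)) * (\<integral>\<^sup>+x. ennreal (exp (S x)) \<partial>measure_pmf P)"
    by (simp add: nn_integral_cmult)
  also have "\<dots> \<le> ennreal (\<delta> * exp (- b)) * ennreal (exp b)"
    using assms by (intro mult_left_mono) auto
  also have "\<dots> = ennreal \<delta>"
    using \<delta> by (simp add: ennreal_mult' [symmetric] exp_minus)
  finally have "measure_pmf.prob P ?bad \<le> \<delta>"
    using \<delta> by (simp add: measure_pmf.emeasure_eq_measure)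
  moreover have "measure_pmf.prob P ?bad = 1 - measure_pmf.prob P {x. S x \<le> b + ln (1 / \<delta>)}"
  proof -
    have "?bad = UNIV - {x. S x \<le> b + ln (1 / \<delta>)}" by auto
    then show ?thesis
      using measure_pmf.prob_compl [of "{x. S x \<le> b + ln (1 / \<delta>)}" P] by simp
  qed
  ultimately show ?thesis by simp
qed

subsection \<open>The regret bound\<close>

text \<open>The cross term of \<open>loss_quantity\<close> is a sum of products of nonnegative
  factors, so \<open>loss_quantity\<close> dominates the other two sums.\<close>

lemma sum_slack_le:
  assumes "exp3_instance N T l lam \<delta> Q"
  shows "2 * (\<Sum>t=1..T. \<Sum>i=1..N. (slack l lam i t)\<^sup>2) + 1/2 * quad_spread N T lam \<le> Q"
proof -
  have N: "2 \<le> N" and lq: "loss_quantity N T l lam \<le> Q"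
    and s0: "\<And>i t. i \<in> {1..N} \<Longrightarrow> t \<in> {1..T} \<Longrightarrow> 0 \<le> slack l lam i t"
    using assms by (auto simp: exp3_instance_def slack_def)
  have "0 \<le> Max ((\<lambda>i. slack l lam i t) ` {1..N}) * spread N (\<lambda>i. lam i t)" if "t \<in> {1..T}" for t
  proof (rule mult_nonneg_nonneg)
    have "0 \<le> slack l lam 1 t" using s0 [of 1 t] N that by simp
    also have "\<dots> \<le> Max ((\<lambda>i. slack l lam i t) ` {1..N})" using N by (intro Max_ge) auto
    finally show "0 \<le> Max ((\<lambda>i. slack l lam i t) ` {1..N})" .
    have "Min ((\<lambda>i. lam i t) ` {1..N}) \<le> lam 1 t" "lam 1 t \<le> Max ((\<lambda>i. lam i t) ` {1..N})"
      using N by (auto intro!: Min_le Max_ge)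
    then show "0 \<le> spread N (\<lambda>i. lam i t)" by (simp add: spread_def)
  qed
  then have "0 \<le> (\<Sum>t=1..T. Max ((\<lambda>i. slack l lam i t) ` {1..N}) * spread N (\<lambda>i. lam i t))"
    by (intro sum_nonneg) auto
  moreover have "(\<Sum>t=1..T. \<Sum>i=1..N. (slack l lam i t)\<^sup>2)
      = (\<Sum>t=1..T. (L2_set (\<lambda>i. slack l lam i t) {1..N})\<^sup>2)"
    by (simp add: L2_set_def sum_nonneg)
  ultimately show ?thesis using lq by (simp add: loss_quantity_def)
qed

text \<open>A pathwise bound. The mean estimate under the weights is the shrunk slack of the drawn
  expert plus the mean lower bound; its distance to the true loss, and that of the estimate at
  \<open>j\<close> to its target, make up the excess.\<close>

lemma exp3_regret_le:
  fixes l lam :: "nat \<Rightarrow> nat \<Rightarrow> real" and \<beta> \<eta> :: real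
  assumes N: "2 \<le> N" and j: "j \<in> {1..N}" and \<beta>: "0 < \<beta>" and \<eta>: "0 < \<eta>"
    and s: "\<And>i t. i \<in> {1..N} \<Longrightarrow> t \<in> {1..T} \<Longrightarrow> 0 \<le> slack l lam i t"
      "\<And>i t. i \<in> {1..N} \<Longrightarrow> t \<in> {1..T} \<Longrightarrow> \<beta> * slack l lam i t \<le> 1"
    and I: "\<And>t. t < T \<Longrightarrow> I (Suc t) \<in> {1..N}"
  shows "(\<Sum>t=1..T. l (I t) t) - (\<Sum>t=1..T. l j t) \<le>
    ln N / \<eta> + \<eta> * quad_spread N T lam
    + (\<Sum>t<T. round_excess {1..N} \<eta> \<beta> (exp_weight N \<eta> (exp3_est N \<eta> \<beta> l lam I t))
        (\<lambda>i. slack l lam i (Suc t)) (\<lambda>i. lam i (Suc t)) j (I (Suc t)))"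
proof -
  define L where "L = exp3_est N \<eta> \<beta> l lam I"
  define p where "p t = exp_weight N \<eta> (L t)" for t
  \<comment> \<open>Rounds are counted from \<open>0\<close> here: index \<open>t\<close> stands for
    round \<open>Suc t\<close>, whose weights come from the estimates after \<open>t\<close>
    rounds.\<close>
  define s where "s t i = slack l lam i (Suc t)" for t i
  define la where "la t i = lam i (Suc t)" for t i
  define k where "k t = I (Suc t)" for t
  define z where "z t i = slack_est \<beta> (s t i) (p t i)" for t i
  define x where "x t i = shrinkage \<beta> (s t i) (p t i)" for t i
  \<comment> \<open>The spike is evaluated at \<open>k t\<close> instead of \<open>i\<close>; the
    indicator makes both agree, and \<open>exp_weights_step\<close> expects one fixed
    height.\<close>
  define c where "c t i = z t (k t) * of_bool (k t = i) + la t i" for t i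
  define d where "d t = spread N (la t)" for t
  define m where "m t = s t (k t) * min 1 (\<eta> * z t (k t))" for t
  define X where "X t = round_excess {1..N} \<eta> \<beta> (p t) (s t) (la t) j (k t)" for t
  have p01: "0 < p t i" "i \<in> {1..N} \<Longrightarrow> p t i < 1" for t i
    using N by (auto simp: p_def exp_weight_pos exp_weight_less_1)
  have sum_p: "(\<Sum>i=1..N. p t i) = 1" for t
    unfolding p_def using N by (intro sum_exp_weight) simp
  have s01: "0 \<le> s t i" "\<beta> * s t i \<le> 1" if "i \<in> {1..N}" "t < T" for t i
    using assms(5,6) [of i "Suc t"] that by (auto simp: s_def)
  have kN: "k t \<in> {1..N}" if "t < T" for t
    using I that by (simp add: k_def)
  have L0: "L 0 i = 0" for i by (simp add: L_def)
  have LS: "L (Suc t) i = L t i + c t i" for t i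
    by (auto simp: L_def c_def z_def s_def p_def la_def k_def slack_est_def Let_def)
  have LT: "L n i = (\<Sum>t<n. c t i)" for n i
    by (induction n) (simp_all add: L0 LS)
  have pz: "p t (k t) * z t (k t) = s t (k t) * (1 - x t (k t))" if "t < T" for t
    unfolding z_def x_def using p01 s01 kN that \<beta> by (intro mult_slack_est) auto
  have weights: "(\<Sum>t<T. \<Sum>i=1..N. p t i * c t i) - L T j \<le> ln N / \<eta> + (\<Sum>t<T. m t + \<eta> * (d t)\<^sup>2)"
    unfolding p_def
  proof (rule exp_weights_regret [where L = L and c = c and r = "\<lambda>t. m t + \<eta> * (d t)\<^sup>2"])
    fix t assume t: "t < T"
    note k = kN [OF t]
    have "(\<Sum>i=1..N. p t i * exp (- \<eta> * (z t (k t) * of_bool (k t = i) + la t i)))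
      \<le> exp (- \<eta> * (\<Sum>i=1..N. p t i * (z t (k t) * of_bool (k t = i) + la t i))
          + \<eta> * (s t (k t) * min 1 (\<eta> * z t (k t))
            + \<eta> * (Max (la t ` {1..N}) - Min (la t ` {1..N}))\<^sup>2))"
    proof (rule exp_weights_step)
      show "0 \<le> z t (k t)"
        unfolding z_def using p01 s01 k t \<beta> by (intro slack_est_nonneg) auto
      show "p t (k t) * z t (k t) \<le> s t (k t)"
        unfolding z_def using p01 s01 k t \<beta> by (intro mult_slack_est_le) auto
    qed (use p01 sum_p k \<eta> in \<open>auto intro: less_imp_le\<close>)
    then show "(\<Sum>i=1..N. exp_weight N \<eta> (L t) i * exp (- \<eta> * c t i))
      \<le> exp (- \<eta> * (\<Sum>i=1..N. exp_weight N \<eta> (L t) i * c t i) + \<eta> * (m t + \<eta> * (d t)\<^sup>2))"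
      by (simp only: c_def m_def d_def p_def spread_def)
  qed (use N \<eta> j L0 LS in auto)
  \<comment> \<open>An exact identity: \<open>m t\<close> is subtracted because \<open>X t\<close>
    contains it, and it cancels the same cost in \<open>weights\<close>.\<close>
  have round: "l (I (Suc t)) (Suc t) - l j (Suc t)
      = (\<Sum>i=1..N. p t i * c t i) - c t j + X t - m t" if t: "t < T" for t
  proof -
    have "(\<Sum>i=1..N. p t i * c t i)
        = (\<Sum>i=1..N. (if k t = i then p t i * z t (k t) else 0) + p t i * la t i)"
      by (intro sum.cong) (auto simp: c_def algebra_simps)
    also have "\<dots> = s t (k t) * (1 - x t (k t)) + (\<Sum>i=1..N. p t i * la t i)"
      using kN [OF t] pz [OF t] by (simp add: sum.distrib)
    finally have pc: "(\<Sum>i=1..N. p t i * c t i) = \<dots>" .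
    have l: "l i (Suc t) = s t i + la t i" for i
      by (simp add: s_def la_def slack_def)
    show ?thesis
      unfolding pc
      unfolding X_def round_excess_def m_def c_def l k_def [symmetric]
      unfolding z_def [symmetric] x_def [symmetric]
      by (cases "k t = j") (simp_all add: algebra_simps)
  qed
  have "(\<Sum>t=1..T. l (I t) t) - (\<Sum>t=1..T. l j t)
      = (\<Sum>t<T. l (I (Suc t)) (Suc t) - l j (Suc t))"
    by (simp add: sum.atLeast1_atMost_eq sum_subtractf)
  also have "\<dots> = (\<Sum>t<T. (\<Sum>i=1..N. p t i * c t i) - c t j + X t - m t)"
    by (intro sum.cong) (auto simp: round)
  also have "\<dots> = (\<Sum>t<T. \<Sum>i=1..N. p t i * c t i) - L T j + (\<Sum>t<T. X t) - (\<Sum>t<T. m t)"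
    by (simp add: LT sum.distrib sum_subtractf)
  also have "\<dots> \<le> ln N / \<eta> + \<eta> * (\<Sum>t<T. (d t)\<^sup>2) + (\<Sum>t<T. X t)"
    using weights by (simp add: sum.distrib sum_distrib_left)
  also have "(\<Sum>t<T. (d t)\<^sup>2) = quad_spread N T lam"
    by (simp add: quad_spread_def sum.atLeast1_atMost_eq d_def la_def [abs_def])
  finally show ?thesis
    by (simp add: X_def p_def L_def s_def [abs_def] la_def [abs_def] k_def)
qed

text \<open>Markov's inequality is applied to \<open>\<beta> / 4\<close> times the total excess.
  Undoing the scaling gives \<open>12 * \<beta> * Q + 4 * \<eta> * Q\<close> and the logarithm with
  factor \<open>4 / \<beta>\<close>; a further \<open>2 * \<eta> * Q\<close> comes from
  \<open>quad_spread N T lam \<le> 2 * Q\<close>.\<close>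

lemma exp3_regret_high_prob:
  fixes l lam :: "nat \<Rightarrow> nat \<Rightarrow> real" and \<beta> :: real
  assumes inst: "exp3_instance N T l lam \<delta> Q" and \<beta>: "0 < \<beta>"
    and s1: "\<And>i t. i \<in> {1..N} \<Longrightarrow> t \<in> {1..T} \<Longrightarrow> \<beta> * slack l lam i t \<le> 1"
  defines "\<eta> \<equiv> sqrt (4 / Q * ln N)"
  assumes B: "ln N / \<eta> + 6 * \<eta> * Q + 12 * \<beta> * Q + 4 / \<beta> * ln (1 / \<delta>) \<le> B"
  shows "prob_regret_le N T l lam Q \<beta> B \<ge> 1 - \<delta>"
proof -
  have N: "2 \<le> N" and \<delta>: "0 < \<delta>" "\<delta> < 1" and Q: "0 < Q"
    and lam_le: "\<And>i t. i \<in> {1..N} \<Longrightarrow> t \<in> {1..T} \<Longrightarrow> lam i t \<le> l i t"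
    using inst by (auto simp: exp3_instance_def)
  have \<eta>: "0 < \<eta>" using N Q by (simp add: \<eta>_def)
  have s0: "0 \<le> slack l lam i t" if "i \<in> {1..N}" "t \<in> {1..T}" for i t
    using lam_le that by (simp add: slack_def)
  \<comment> \<open>The comparator is fixed before any draw, so no union over experts is
    taken.\<close>
  have "Min ((\<lambda>j. \<Sum>t=1..T. l j t) ` {1..N}) \<in> (\<lambda>j. \<Sum>t=1..T. l j t) ` {1..N}"
    using N by (intro Min_in) auto
  then obtain j where j: "j \<in> {1..N}" "Min ((\<lambda>j. \<Sum>t=1..T. l j t) ` {1..N}) = (\<Sum>t=1..T. l j t)"
    by auto
  define S where "S t = (\<Sum>i=1..N. (slack l lam i (Suc t))\<^sup>2)" for t
  define d where "d t = spread N (\<lambda>i. lam i (Suc t))" for t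
  define b where "b t = 2 * \<beta> * (\<beta> + \<eta>) * S t + \<beta>\<^sup>2 * (d t)\<^sup>2" for t
  define X where "X L t i = round_excess {1..N} \<eta> \<beta> (exp_weight N \<eta> L)
    (\<lambda>i. slack l lam i (Suc t)) (\<lambda>i. lam i (Suc t)) j i" for L t i
  define P where "P = exp3_run N \<eta> \<beta> l lam T"
  define Y where "Y I = (\<Sum>t<T. \<beta> / 4 * X (exp3_est N \<eta> \<beta> l lam I t) t (I (Suc t)))" for I
  have mgf: "(\<Sum>i=1..N. exp_weight N \<eta> L i * exp (\<beta> / 4 * X L t i)) \<le> exp (b t)"
    if t: "t < T" for L t
  proof -
    have pmf: "pmf (exp3_draw N \<eta> L) i = exp_weight N \<eta> L i" if "i \<in> {1..N}" for i
      using N that by (subst pmf_exp3_draw) auto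
    have "(\<Sum>i=1..N. exp_weight N \<eta> L i * exp (\<beta> / 4 * X L t i))
      = (\<Sum>i=1..N. pmf (exp3_draw N \<eta> L) i * exp (\<beta> / 4 * round_excess {1..N} \<eta> \<beta>
          (pmf (exp3_draw N \<eta> L)) (\<lambda>i. slack l lam i (Suc t)) (\<lambda>i. lam i (Suc t)) j i))"
      using j by (intro sum.cong) (auto simp: X_def round_excess_def pmf)
    also have "\<dots> \<le> exp (2 * \<beta> * (\<beta> + \<eta>) * (\<Sum>i=1..N. (slack l lam i (Suc t))\<^sup>2)
        + \<beta>\<^sup>2 * (Max ((\<lambda>i. lam i (Suc t)) ` {1..N}) - Min ((\<lambda>i. lam i (Suc t)) ` {1..N}))\<^sup>2)"
      using N \<eta> \<beta> j s0 s1 t set_pmf_exp3_draw [of N \<eta> L]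
      by (intro round_excess_mgf) (auto simp: pmf exp_weight_pos exp_weight_less_1)
    finally show ?thesis by (simp add: b_def S_def d_def spread_def)
  qed
  have lq': "2 * (\<Sum>t<T. S t) + 1/2 * (\<Sum>t<T. (d t)\<^sup>2) \<le> Q"
    using sum_slack_le [OF inst]
    by (simp add: quad_spread_def sum.atLeast1_atMost_eq S_def d_def)
  moreover have nn: "0 \<le> (\<Sum>t<T. S t)" "0 \<le> (\<Sum>t<T. (d t)\<^sup>2)"
    by (auto intro!: sum_nonneg simp: S_def)
  ultimately have S_le: "(\<Sum>t<T. S t) \<le> Q / 2" and d_le: "(\<Sum>t<T. (d t)\<^sup>2) \<le> 2 * Q"
    by auto
  have "(\<Sum>t<T. b t) = 2 * \<beta> * (\<beta> + \<eta>) * (\<Sum>t<T. S t) + \<beta>\<^sup>2 * (\<Sum>t<T. (d t)\<^sup>2)"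
    by (simp add: b_def sum.distrib sum_distrib_left)
  also have "\<dots> \<le> 2 * \<beta> * (\<beta> + \<eta>) * (Q / 2) + \<beta>\<^sup>2 * (2 * Q)"
    using S_le d_le \<beta> \<eta> by (intro add_mono mult_left_mono) auto
  also have "\<dots> = \<beta> / 4 * (12 * \<beta> * Q + 4 * \<eta> * Q)"
    by (simp add: power2_eq_square algebra_simps)
  finally have b_le: "(\<Sum>t<T. b t) \<le> \<beta> / 4 * (12 * \<beta> * Q + 4 * \<eta> * Q)" .
  have "(\<integral>\<^sup>+I. ennreal (exp (Y I)) \<partial>measure_pmf P) \<le> ennreal (exp (\<Sum>t<T. b t))"
    unfolding Y_def P_def using N mgf by (intro nn_integral_exp3_run_le) auto
  then have "1 - \<delta> \<le> measure_pmf.prob P {I. Y I \<le> (\<Sum>t<T. b t) + ln (1 / \<delta>)}"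
    using \<delta> by (intro pmf_exp_Markov) auto
  \<comment> \<open>The inclusion is only almost sure: the pathwise bound needs every draw in
    \<open>{1..N}\<close>, which holds on the support of the run.\<close>
  also have "\<dots> \<le> measure_pmf.prob P {I. regret N T l I \<le> B}"
  proof (rule measure_pmf.finite_measure_mono_AE)
    show "AE I in measure_pmf P. I \<in> {I. Y I \<le> (\<Sum>t<T. b t) + ln (1 / \<delta>)} \<longrightarrow>
      I \<in> {I. regret N T l I \<le> B}"
      unfolding AE_measure_pmf_iff
    proof (intro ballI impI)
      fix I assume I: "I \<in> set_pmf P" and "I \<in> {I. Y I \<le> (\<Sum>t<T. b t) + ln (1 / \<delta>)}"
      then have Y: "Y I \<le> (\<Sum>t<T. b t) + ln (1 / \<delta>)" by simp
      have "regret N T l I \<le> ln N / \<eta> + \<eta> * quad_spread N T lam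
          + (\<Sum>t<T. X (exp3_est N \<eta> \<beta> l lam I t) t (I (Suc t)))"
        unfolding regret_def j(2) X_def
      proof (rule exp3_regret_le [OF N j(1) \<beta> \<eta> s0 s1])
        show "I (Suc t) \<in> {1..N}" if "t < T" for t
          using exp3_run_range [OF _ I [unfolded P_def] that] N by simp
      qed
      also have "(\<Sum>t<T. X (exp3_est N \<eta> \<beta> l lam I t) t (I (Suc t))) = 4 / \<beta> * Y I"
        using \<beta> by (simp add: Y_def sum_distrib_left)
      also have "\<dots> \<le> 4 / \<beta> * (\<beta> / 4 * (12 * \<beta> * Q + 4 * \<eta> * Q) + ln (1 / \<delta>))"
        using Y b_le \<beta> by (intro mult_left_mono) auto
      also have "\<dots> = 12 * \<beta> * Q + 4 * \<eta> * Q + 4 / \<beta> * ln (1 / \<delta>)"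
        using \<beta> by (simp add: field_simps)
      also have "\<eta> * quad_spread N T lam \<le> \<eta> * (2 * Q)"
        using d_le \<eta> by (simp add: quad_spread_def sum.atLeast1_atMost_eq d_def)
      finally show "I \<in> {I. regret N T l I \<le> B}" using B by (simp add: mult_ac)
    qed
  qed simp
  finally show ?thesis
    by (simp add: prob_regret_le_def P_def \<eta>_def)
qed

subsection \<open>Tuning\<close>

lemma prob_regret_le_mono:
  "B \<le> B' \<Longrightarrow> prob_regret_le N T l lam Q \<beta> B \<le> prob_regret_le N T l lam Q \<beta> B'"
  unfolding prob_regret_le_def by (intro measure_pmf.finite_measure_mono) auto

text \<open>The first term is \<open>1/2\<close> and the second \<open>12\<close> times
  \<open>sqrt (Q * ln n)\<close>.\<close>

lemma learning_rate_terms: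
  fixes n Q :: real
  assumes "1 < n" "0 < Q"
  defines "\<eta> \<equiv> sqrt (4 / Q * ln n)"
  shows "ln n / \<eta> + 6 * \<eta> * Q = 25/2 * sqrt (Q * ln n)"
proof -
  define a q where "a = sqrt (ln n)" and "q = sqrt Q"
  have pos: "0 < a" "0 < q" and sq: "ln n = a * a" "Q = q * q"
    using assms by (auto simp: a_def q_def)
  have \<eta>: "\<eta> = 2 * a / q"
    using assms by (simp add: \<eta>_def a_def q_def real_sqrt_mult real_sqrt_divide)
  have "sqrt (Q * ln n) = a * q"
    by (simp add: a_def q_def real_sqrt_mult)
  then show ?thesis
    using pos unfolding \<eta> sq by (simp add: field_simps)
qed

text \<open>Serves both choices of \<open>\<beta>\<close>: \<open>K\<close> is the confidence
  logarithm in one and \<open>1\<close> in the other. The constants \<open>18\<close> and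
  \<open>3\<close> come from \<open>4/3 \<le> sqrt 2 \<le> 3/2\<close>.\<close>

lemma exploration_terms:
  fixes K Q :: real
  assumes "0 < K" "0 < Q"
  defines "\<beta> \<equiv> sqrt (2 / Q * K)"
  shows "12 * \<beta> * Q \<le> 18 * sqrt (Q * K)" "4 / \<beta> \<le> 3 * sqrt (Q / K)"
proof -
  define a q where "a = sqrt K" and "q = sqrt Q"
  have pos: "0 < a" "0 < q" and sq: "K = a * a" "Q = q * q"
    using assms by (auto simp: a_def q_def)
  have \<beta>: "\<beta> = sqrt 2 * a / q"
    using assms by (simp add: \<beta>_def a_def q_def real_sqrt_mult real_sqrt_divide)
  have r: "sqrt 2 \<le> 3/2" "4/3 \<le> sqrt 2"
    by (rule real_le_lsqrt real_le_rsqrt; simp add: power2_eq_square)+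
  have "sqrt 2 * (a * q) \<le> 3/2 * (a * q)"
    using r pos by (intro mult_right_mono) auto
  moreover have "12 * \<beta> * Q = 12 * (sqrt 2 * (a * q))"
    using pos unfolding \<beta> sq by simp
  moreover have "sqrt (Q * K) = a * q"
    by (simp add: a_def q_def real_sqrt_mult)
  ultimately show "12 * \<beta> * Q \<le> 18 * sqrt (Q * K)" by linarith
  have "4 / \<beta> = 4 / sqrt 2 * (q / a)"
    using pos unfolding \<beta> by simp
  also have "\<dots> \<le> 3 * (q / a)"
    using r pos by (intro mult_right_mono) (auto simp: divide_le_eq)
  also have "q / a = sqrt (Q / K)"
    by (simp add: a_def q_def real_sqrt_divide)
  finally show "4 / \<beta> \<le> 3 * sqrt (Q / K)" .
qed

lemma confidence_logs:
  fixes \<delta> :: real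
  assumes "2 \<le> N" "0 < \<delta>" "\<delta> < 1"
  shows "ln (real N) \<le> ln (real N / \<delta>)" "0 < ln (1 / \<delta>)" "ln (1 / \<delta>) \<le> ln (real N / \<delta>)"
    "1/2 \<le> ln (real N / \<delta>)" "ln (real N / \<delta>) \<le> ln ((real N + 3) / \<delta>)"
    "ln ((real N + 3) / \<delta>) \<le> 4 * ln (real N / \<delta>)"
proof -
  have N: "2 \<le> real N" using assms by simp
  have \<delta>: "0 < ln (1 / \<delta>)" using assms by simp
  have eqs: "ln (real N / \<delta>) = ln (real N) + ln (1 / \<delta>)"
    "ln ((real N + 3) / \<delta>) = ln (real N + 3) + ln (1 / \<delta>)"
    using assms N by (simp_all add: ln_div)
  have "ln 2 \<le> ln (real N)" using N by simp
  then have ln_N: "1/2 \<le> ln (real N)" using ln2_ge_two_thirds by linarith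
  \<comment> \<open>Leads to \<open>N + 3 \<le> N ^ 4\<close>, the source of the factor
    \<open>4\<close> between the two logarithms.\<close>
  have "real N * 4 \<le> real N * real N ^ 3"
  proof (intro mult_left_mono)
    have "(2::real) ^ 3 \<le> real N ^ 3" using N by (intro power_mono) auto
    then show "4 \<le> real N ^ 3" by simp
  qed simp
  moreover have "real N * real N ^ 3 = real N ^ 4"
    by (simp add: eval_nat_numeral)
  ultimately have "real N + 3 \<le> real N ^ 4"
    using N by linarith
  then have "ln (real N + 3) \<le> ln (real N ^ 4)" using N by simp
  then have "ln (real N + 3) \<le> 4 * ln (real N)" using N by (simp add: ln_realpow)
  with eqs \<delta> ln_N show
    "ln (real N) \<le> ln (real N / \<delta>)" "0 < ln (1 / \<delta>)" "ln (1 / \<delta>) \<le> ln (real N / \<delta>)"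
    "1/2 \<le> ln (real N / \<delta>)" "ln (real N / \<delta>) \<le> ln ((real N + 3) / \<delta>)"
    "ln ((real N + 3) / \<delta>) \<le> 4 * ln (real N / \<delta>)"
    using N by auto
qed

lemma exp3_regret_tuned:
  assumes inst: "exp3_instance N T l lam \<delta> Q"
    and \<beta>: "\<beta> = sqrt (2 / Q * ln ((real N + 3) / \<delta>))"
    and s: "\<And>i t. i \<in> {1..N} \<Longrightarrow> t \<in> {1..T} \<Longrightarrow> \<beta> * slack l lam i t \<le> 1"
  shows "1 - \<delta> \<le> prob_regret_le N T l lam Q \<beta> (68 * sqrt (Q * ln (real N / \<delta>)))"
proof (rule exp3_regret_high_prob [OF inst _ s])
  have N: "2 \<le> N" and \<delta>: "0 < \<delta>" "\<delta> < 1" and Q: "0 < Q"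
    using inst by (auto simp: exp3_instance_def)
  define K where "K = ln ((real N + 3) / \<delta>)"
  note logs = confidence_logs [OF N \<delta>, folded K_def]
  have K: "0 < K" using logs by linarith
  show "0 < \<beta>" using K Q by (simp add: \<beta> K_def)
  have "ln N / sqrt (4 / Q * ln N) + 6 * sqrt (4 / Q * ln N) * Q = 25/2 * sqrt (Q * ln N)"
    using N Q by (intro learning_rate_terms) auto
  also have "\<dots> \<le> 13 * sqrt (Q * K)"
    using logs Q N by (intro mult_mono real_sqrt_le_mono mult_left_mono) auto
  finally have 1: "ln N / sqrt (4 / Q * ln N) + 6 * sqrt (4 / Q * ln N) * Q \<le> 13 * sqrt (Q * K)" .
  have 2: "12 * \<beta> * Q \<le> 18 * sqrt (Q * K)"
    unfolding \<beta> K_def [symmetric] using K Q by (rule exploration_terms)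
  have "4 / \<beta> * ln (1 / \<delta>) \<le> 3 * sqrt (Q / K) * K"
    unfolding \<beta> K_def [symmetric] using K Q logs by (intro mult_mono exploration_terms) auto
  also have "\<dots> = 3 * sqrt (Q * K)"
    using K by (simp add: real_sqrt_divide real_sqrt_mult field_simps)
  finally have 3: "4 / \<beta> * ln (1 / \<delta>) \<le> 3 * sqrt (Q * K)" .
  \<comment> \<open>The three parts add up to \<open>13 + 18 + 3 = 34\<close>; passing from
    \<open>K\<close> to \<open>ln (real N / \<delta>)\<close> doubles this to
    \<open>68\<close>.\<close>
  have "sqrt (Q * K) \<le> sqrt (4 * (Q * ln (real N / \<delta>)))"
    using logs Q by (simp add: mult.left_commute)
  also have "\<dots> = 2 * sqrt (Q * ln (real N / \<delta>))"
    by (simp add: real_sqrt_mult)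
  finally show "ln N / sqrt (4 / Q * ln N) + 6 * sqrt (4 / Q * ln N) * Q + 12 * \<beta> * Q
      + 4 / \<beta> * ln (1 / \<delta>) \<le> 68 * sqrt (Q * ln (real N / \<delta>))"
    using 1 2 3 by linarith
qed

lemma exp3_regret_untuned:
  assumes inst: "exp3_instance N T l lam \<delta> Q" and \<beta>: "\<beta> = sqrt (2 / Q)"
  shows "1 - \<delta> \<le> prob_regret_le N T l lam Q \<beta> (68 * (sqrt Q * ln (real N / \<delta>)))"
proof (rule exp3_regret_high_prob [OF inst])
  have N: "2 \<le> N" and \<delta>: "0 < \<delta>" "\<delta> < 1" and Q: "0 < Q"
    using inst by (auto simp: exp3_instance_def)
  define K where "K = ln (real N / \<delta>)"
  note logs = confidence_logs [OF N \<delta>, folded K_def]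
  show "0 < \<beta>" using Q by (simp add: \<beta>)
  \<comment> \<open>With this \<open>\<beta>\<close> the condition is automatic: each squared slack
    is at most \<open>Q / 2 = 1 / \<beta>\<^sup>2\<close>.\<close>
  show "\<beta> * slack l lam i t \<le> 1" if i: "i \<in> {1..N}" and t: "t \<in> {1..T}" for i t
  proof -
    have "(slack l lam i t)\<^sup>2 \<le> (\<Sum>i=1..N. (slack l lam i t)\<^sup>2)"
      using i by (intro member_le_sum) auto
    also have "\<dots> \<le> (\<Sum>t=1..T. \<Sum>i=1..N. (slack l lam i t)\<^sup>2)"
      using t by (intro member_le_sum [of t _ "\<lambda>t. \<Sum>i=1..N. (slack l lam i t)\<^sup>2"]) (auto intro: sum_nonneg)
    also have "\<dots> \<le> Q / 2"
      using sum_slack_le [OF inst] sum_nonneg [of "{1..T}" "\<lambda>t. (spread N (\<lambda>i. lam i t))\<^sup>2"]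
      by (simp add: quad_spread_def)
    finally have "(\<beta> * slack l lam i t)\<^sup>2 \<le> 1"
      using Q by (simp add: \<beta> power_mult_distrib field_simps)
    then show ?thesis
      by (rule power2_le_imp_le [of _ 1, simplified])
  qed
  have "ln N / sqrt (4 / Q * ln N) + 6 * sqrt (4 / Q * ln N) * Q = 25/2 * sqrt (Q * ln N)"
    using N Q by (intro learning_rate_terms) auto
  also have "\<dots> = 25/2 * (sqrt Q * sqrt (ln N))"
    by (simp add: real_sqrt_mult)
  \<comment> \<open>Since \<open>1/2 \<le> K\<close>, one has
    \<open>ln N \<le> K \<le> (2 * K)\<^sup>2\<close>.\<close>
  also have "sqrt (ln N) \<le> 2 * K"
  proof (rule real_le_lsqrt)
    have "ln N * 1 \<le> K * (4 * K)" using logs N by (intro mult_mono) auto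
    then show "ln N \<le> (2 * K)\<^sup>2" by (simp add: power2_eq_square)
  qed (use logs in auto)
  finally have 1: "ln N / sqrt (4 / Q * ln N) + 6 * sqrt (4 / Q * ln N) * Q \<le> 25 * (sqrt Q * K)"
    using Q by (simp add: mult_left_mono mult_ac)
  have "12 * \<beta> * Q \<le> 18 * sqrt Q"
    using exploration_terms(1) [of 1 Q] Q by (simp add: \<beta>)
  also have "\<dots> \<le> 18 * (sqrt Q * (2 * K))"
    using logs Q by simp
  finally have 2: "12 * \<beta> * Q \<le> 36 * (sqrt Q * K)" by simp
  have "4 / \<beta> * ln (1 / \<delta>) \<le> 3 * sqrt Q * K"
    using exploration_terms(2) [of 1 Q] Q logs by (intro mult_mono) (auto simp: \<beta>)
  then have "4 / \<beta> * ln (1 / \<delta>) \<le> 3 * (sqrt Q * K)" by simp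
  \<comment> \<open>The constants \<open>25 + 36 + 3\<close> give \<open>64\<close>; nonnegativity
    allows raising this to \<open>68\<close>.\<close>
  moreover have "0 \<le> sqrt Q * K" using logs Q by simp
  ultimately show "ln N / sqrt (4 / Q * ln N) + 6 * sqrt (4 / Q * ln N) * Q + 12 * \<beta> * Q
      + 4 / \<beta> * ln (1 / \<delta>) \<le> 68 * (sqrt Q * ln (real N / \<delta>))"
    using 1 2 unfolding K_def by linarith
qed

lemma exp3_regret_unit_losses:
  assumes inst: "exp3_instance N T l lam \<delta> Q"
    and unit: "\<forall>i\<in>{1..N}. \<forall>t\<in>{1..T}. l i t \<in> {0..1} \<and> 0 \<le> lam i t"
    and TQ: "2 * real T \<le> Q"
    and \<beta>: "\<beta> = min 1 (sqrt (2 / Q * ln ((real N + 3) / \<delta>)))"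
  shows "1 - \<delta> \<le> prob_regret_le N T l lam Q \<beta> (68 * sqrt (Q * ln (real N / \<delta>)))"
proof (cases "sqrt (2 / Q * ln ((real N + 3) / \<delta>)) \<le> 1")
  case True
  then have eq: "\<beta> = sqrt (2 / Q * ln ((real N + 3) / \<delta>))" by (simp add: \<beta>)
  show ?thesis
  proof (rule exp3_regret_tuned [OF inst eq])
    show "\<beta> * slack l lam i t \<le> 1" if "i \<in> {1..N}" "t \<in> {1..T}" for i t
    proof -
      have "0 \<le> slack l lam i t"
        using inst that by (auto simp: exp3_instance_def slack_def)
      moreover have "l i t \<le> 1" "0 \<le> lam i t" using unit that by auto
      moreover have "\<beta> \<le> 1" by (simp add: \<beta>)
      ultimately show ?thesis
        using mult_mono [of \<beta> 1 "slack l lam i t" 1] by (simp add: slack_def)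
    qed
  qed
next
  case False
  have N: "2 \<le> N" and \<delta>: "0 < \<delta>" "\<delta> < 1" and Q: "0 < Q"
    using inst by (auto simp: exp3_instance_def)
  have "1 \<le> 2 / Q * ln ((real N + 3) / \<delta>)"
    using False by (metis linear real_sqrt_le_1_iff)
  also have "\<dots> \<le> 2 / Q * (4 * ln (real N / \<delta>))"
    using confidence_logs [OF N \<delta>] Q by (intro mult_left_mono) auto
  finally have "Q \<le> 8 * ln (real N / \<delta>)"
    using Q by (simp add: field_simps)
  then have "Q * Q \<le> Q * (8 * ln (real N / \<delta>))"
    using Q by (intro mult_left_mono) auto
  \<comment> \<open>The generous \<open>136\<close> is twice \<open>68\<close>, as \<open>T\<close>
    is at most half of \<open>Q\<close>.\<close>
  also have "\<dots> \<le> 136\<^sup>2 * (Q * ln (real N / \<delta>))"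
    using confidence_logs [OF N \<delta>] Q by simp
  finally have "sqrt (Q * Q) \<le> sqrt (136\<^sup>2 * (Q * ln (real N / \<delta>)))"
    by (rule real_sqrt_le_mono)
  then have "Q \<le> 136 * sqrt (Q * ln (real N / \<delta>))"
    using Q by (simp add: real_sqrt_mult del: real_sqrt_mult_self)
  then have T: "real T \<le> 68 * sqrt (Q * ln (real N / \<delta>))" using TQ by simp
  have "regret N T l I \<le> T" if I: "I \<in> set_pmf (exp3_run N (sqrt (4 / Q * ln N)) \<beta> l lam T)" for I
  proof -
    have "l (I t) t \<le> 1" if "t \<in> {1..T}" for t
      using exp3_run_range [OF _ I, of "t - 1"] N that unit by auto
    then have "(\<Sum>t=1..T. l (I t) t) \<le> (\<Sum>t=1..T. 1)" by (intro sum_mono) auto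
    moreover have "0 \<le> Min ((\<lambda>j. \<Sum>t=1..T. l j t) ` {1..N})"
      using N unit by (subst Min_ge_iff) (auto intro!: sum_nonneg)
    ultimately show ?thesis by (simp add: regret_def)
  qed
  then have "prob_regret_le N T l lam Q \<beta> (68 * sqrt (Q * ln (real N / \<delta>))) = 1"
    unfolding prob_regret_le_def using T
    by (subst measure_pmf.prob_eq_1) (force simp: AE_measure_pmf_iff)+
  then show ?thesis using \<delta> by simp
qed

section \<open>The bandit and full-information settings\<close>

text \<open>The spreads vanish and each slack is at most \<open>1\<close>, so only the norms
  contribute.\<close>

lemma loss_quantity_bandit:
  assumes "1 \<le> N" "\<forall>i\<in>{1..N}. \<forall>t\<in>{1..T}. l i t \<in> {0..1} \<and> lam i t = 0"
  shows "loss_quantity N T l lam \<le> 2 * real N * real T"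
proof -
  have spread: "spread N (\<lambda>i. lam i t) = 0" if "t \<in> {1..T}" for t
  proof -
    have "(\<lambda>i. lam i t) ` {1..N} = {0}" using assms that by (auto simp: image_iff)
    then show ?thesis by (simp add: spread_def)
  qed
  have "(L2_set (\<lambda>i. slack l lam i t) {1..N})\<^sup>2 \<le> real N" if "t \<in> {1..T}" for t
  proof -
    have "(L2_set (\<lambda>i. slack l lam i t) {1..N})\<^sup>2 = (\<Sum>i=1..N. (slack l lam i t)\<^sup>2)"
      by (simp add: L2_set_def sum_nonneg)
    also have "\<dots> \<le> (\<Sum>i=1..N. 1)"
      using assms that by (intro sum_mono) (auto simp: slack_def power_le_one)
    finally show ?thesis by simp
  qed
  then have "(\<Sum>t=1..T. (L2_set (\<lambda>i. slack l lam i t) {1..N})\<^sup>2) \<le> (\<Sum>t=1..T. real N)"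
    by (intro sum_mono) auto
  then show ?thesis
    using spread by (simp add: loss_quantity_def quad_spread_def mult.commute)
qed

text \<open>Only \<open>quad_spread\<close> contributes, at most \<open>T / 2\<close> after
  weighting; the bound is stated as \<open>2 * T\<close> to match the requirement
  \<open>2 * T \<le> Q\<close>.\<close>

lemma loss_quantity_full_information:
  assumes "1 \<le> N" "\<forall>i\<in>{1..N}. \<forall>t\<in>{1..T}. l i t \<in> {0..1} \<and> lam i t = l i t"
  shows "loss_quantity N T l lam \<le> 2 * real T"
proof -
  have slack: "slack l lam i t = 0" if "i \<in> {1..N}" "t \<in> {1..T}" for i t
    using assms that by (simp add: slack_def)
  have norm: "L2_set (\<lambda>i. slack l lam i t) {1..N} = 0" if "t \<in> {1..T}" for t
    using slack that by (simp add: L2_set_def)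
  have max: "Max ((\<lambda>i. slack l lam i t) ` {1..N}) = 0" if "t \<in> {1..T}" for t
  proof -
    have "(\<lambda>i. slack l lam i t) ` {1..N} = {0}" using assms slack that by (auto simp: image_iff)
    then show ?thesis by simp
  qed
  have "(spread N (\<lambda>i. lam i t))\<^sup>2 \<le> 1" if "t \<in> {1..T}" for t
  proof -
    let ?A = "(\<lambda>i. lam i t) ` {1..N}"
    have A: "finite ?A" "?A \<noteq> {}" "?A \<subseteq> {0..1}" using assms that by auto
    then have "Max ?A \<in> {0..1}" "Min ?A \<in> {0..1}" using Max_in Min_in by blast+
    moreover have "Min ?A \<le> Max ?A" using A by (meson Max_in Min_le)
    ultimately show ?thesis by (auto simp: spread_def intro!: power_le_one)
  qed
  then have "quad_spread N T lam \<le> (\<Sum>t=1..T. 1)"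
    unfolding quad_spread_def by (intro sum_mono) auto
  then show ?thesis
    using norm max by (simp add: loss_quantity_def)
qed

lemma sqrt_two_mult_le: "0 \<le> x \<Longrightarrow> 68 * sqrt (2 * x) \<le> 136 * sqrt x"
  using real_sqrt_le_mono [of "2 * x" "2\<^sup>2 * x"] by (simp add: real_sqrt_mult mult.commute)

theorem theorem13:
  shows
    "(\<exists>C>0. \<forall>N T l lam \<delta> Q \<beta>.
        exp3_instance N T l lam \<delta> Q \<and>
        \<beta> = sqrt (2 / Q * ln ((real N + 3) / \<delta>)) \<and>
        \<beta> * max_slack N T l lam \<le> 1 \<longrightarrow>
        prob_regret_le N T l lam Q \<beta> (C * sqrt (Q * ln (real N / \<delta>))) \<ge> 1 - \<delta>) \<and>
     (\<exists>C>0. \<forall>N T l lam \<delta> Q \<beta>.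
        exp3_instance N T l lam \<delta> Q \<and>
        \<beta> = sqrt (2 / Q) \<longrightarrow>
        prob_regret_le N T l lam Q \<beta> (C * (sqrt Q * ln (real N / \<delta>))) \<ge> 1 - \<delta>) \<and>
     (\<exists>C>0.
        (\<forall>N T l lam \<delta> Q \<beta>.
          exp3_instance N T l lam \<delta> Q \<and>
          (\<forall>i\<in>{1..N}. \<forall>t\<in>{1..T}. l i t \<in> {0..1} \<and> 0 \<le> lam i t) \<and>
          2 * real T \<le> Q \<and>
          \<beta> = min 1 (sqrt (2 / Q * ln ((real N + 3) / \<delta>))) \<longrightarrow>
          prob_regret_le N T l lam Q \<beta> (C * sqrt (Q * ln (real N / \<delta>))) \<ge> 1 - \<delta>) \<and>
        (\<exists>C'>0. \<forall>N T. 2 \<le> N \<and> 1 \<le> T \<longrightarrow>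
          (\<exists>Q. 2 * real T \<le> Q \<and>
            (\<forall>l lam \<delta> \<beta>.
              0 < \<delta> \<and> \<delta> < 1 \<and>
              (\<forall>i\<in>{1..N}. \<forall>t\<in>{1..T}. l i t \<in> {0..1} \<and> lam i t = 0) \<and>
              \<beta> = min 1 (sqrt (2 / Q * ln ((real N + 3) / \<delta>))) \<longrightarrow>
              exp3_instance N T l lam \<delta> Q \<and>
              C * sqrt (Q * ln (real N / \<delta>)) \<le> C' * sqrt (real N * real T * ln (real N / \<delta>)) \<and>
              prob_regret_le N T l lam Q \<beta> (C' * sqrt (real N * real T * ln (real N / \<delta>)))
                \<ge> 1 - \<delta>))) \<and>
        (\<exists>C'>0. \<forall>N T. 2 \<le> N \<and> 1 \<le> T \<longrightarrow>
          (\<exists>Q. 2 * real T \<le> Q \<and>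
            (\<forall>l lam \<delta> \<beta>.
              0 < \<delta> \<and> \<delta> < 1 \<and>
              (\<forall>i\<in>{1..N}. \<forall>t\<in>{1..T}. l i t \<in> {0..1} \<and> lam i t = l i t) \<and>
              \<beta> = min 1 (sqrt (2 / Q * ln ((real N + 3) / \<delta>))) \<longrightarrow>
              exp3_instance N T l lam \<delta> Q \<and>
              C * sqrt (Q * ln (real N / \<delta>)) \<le> C' * sqrt (real T * ln (real N / \<delta>)) \<and>
              prob_regret_le N T l lam Q \<beta> (C' * sqrt (real T * ln (real N / \<delta>)))
                \<ge> 1 - \<delta>))))"
proof (intro conjI)
  show "\<exists>C>0. \<forall>N T l lam \<delta> Q \<beta>.
        exp3_instance N T l lam \<delta> Q \<and>
        \<beta> = sqrt (2 / Q * ln ((real N + 3) / \<delta>)) \<and>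
        \<beta> * max_slack N T l lam \<le> 1 \<longrightarrow>
        prob_regret_le N T l lam Q \<beta> (C * sqrt (Q * ln (real N / \<delta>))) \<ge> 1 - \<delta>"
  proof (intro exI [of _ 68] conjI allI impI; (elim conjE)?)
    fix N T l lam \<delta> Q and \<beta> :: real
    assume inst: "exp3_instance N T l lam \<delta> Q"
      and \<beta>: "\<beta> = sqrt (2 / Q * ln ((real N + 3) / \<delta>))" and max: "\<beta> * max_slack N T l lam \<le> 1"
    have "0 \<le> \<beta>"
      using inst confidence_logs [of N \<delta>] by (auto simp: \<beta> exp3_instance_def)
    then have "\<beta> * slack l lam i t \<le> \<beta> * max_slack N T l lam" if "i \<in> {1..N}" "t \<in> {1..T}" for i t
      unfolding max_slack_def using that by (intro mult_left_mono Max_ge) force+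
    with max show "1 - \<delta> \<le> prob_regret_le N T l lam Q \<beta> (68 * sqrt (Q * ln (real N / \<delta>)))"
      by (intro exp3_regret_tuned [OF inst \<beta>]) force
  qed simp
next
  show "\<exists>C>0. \<forall>N T l lam \<delta> Q \<beta>.
        exp3_instance N T l lam \<delta> Q \<and>
        \<beta> = sqrt (2 / Q) \<longrightarrow>
        prob_regret_le N T l lam Q \<beta> (C * (sqrt Q * ln (real N / \<delta>))) \<ge> 1 - \<delta>"
    using exp3_regret_untuned by (intro exI [of _ 68]) auto
next
  have bandit: "\<exists>Q. 2 * real T \<le> Q \<and>
      (\<forall>l lam \<delta> \<beta>.
        0 < \<delta> \<and> \<delta> < 1 \<and>
        (\<forall>i\<in>{1..N}. \<forall>t\<in>{1..T}. l i t \<in> {0..1} \<and> lam i t = 0) \<and>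
        \<beta> = min 1 (sqrt (2 / Q * ln ((real N + 3) / \<delta>))) \<longrightarrow>
        exp3_instance N T l lam \<delta> Q \<and>
        68 * sqrt (Q * ln (real N / \<delta>)) \<le> 136 * sqrt (real N * real T * ln (real N / \<delta>)) \<and>
        prob_regret_le N T l lam Q \<beta> (136 * sqrt (real N * real T * ln (real N / \<delta>)))
          \<ge> 1 - \<delta>)" if NT: "2 \<le> N \<and> 1 \<le> T" for N T
  proof (intro exI [of _ "2 * real N * real T"] conjI allI impI; (elim conjE)?)
    \<comment> \<open>The witness for \<open>Q\<close> is the bound of
      \<open>loss_quantity_bandit\<close>; it depends on \<open>N\<close> and \<open>T\<close>
      alone.\<close>
    show TQ: "2 * real T \<le> 2 * real N * real T" using NT by simp
    fix l lam :: "nat \<Rightarrow> nat \<Rightarrow> real" and \<delta> \<beta> :: real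
    assume \<delta>: "0 < \<delta>" "\<delta> < 1"
      and l: "\<forall>i\<in>{1..N}. \<forall>t\<in>{1..T}. l i t \<in> {0..1} \<and> lam i t = 0"
      and \<beta>: "\<beta> = min 1 (sqrt (2 / (2 * real N * real T) * ln ((real N + 3) / \<delta>)))"
    show inst: "exp3_instance N T l lam \<delta> (2 * real N * real T)"
      using NT \<delta> l loss_quantity_bandit [OF _ l] by (auto simp: exp3_instance_def)
    have "0 \<le> ln (real N / \<delta>)" using confidence_logs(4) [of N \<delta>] NT \<delta> by simp
    then show le: "68 * sqrt (2 * real N * real T * ln (real N / \<delta>))
        \<le> 136 * sqrt (real N * real T * ln (real N / \<delta>))"
      using sqrt_two_mult_le [of "real N * real T * ln (real N / \<delta>)"] by (simp add: mult.assoc)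
    have "1 - \<delta> \<le> prob_regret_le N T l lam (2 * real N * real T) \<beta>
        (68 * sqrt (2 * real N * real T * ln (real N / \<delta>)))"
      using l by (intro exp3_regret_unit_losses [OF inst _ TQ \<beta>]) auto
    also note prob_regret_le_mono [OF le]
    finally show "1 - \<delta> \<le> prob_regret_le N T l lam (2 * real N * real T) \<beta>
        (136 * sqrt (real N * real T * ln (real N / \<delta>)))" .
  qed
  have full: "\<exists>Q. 2 * real T \<le> Q \<and>
      (\<forall>l lam \<delta> \<beta>.
        0 < \<delta> \<and> \<delta> < 1 \<and>
        (\<forall>i\<in>{1..N}. \<forall>t\<in>{1..T}. l i t \<in> {0..1} \<and> lam i t = l i t) \<and>
        \<beta> = min 1 (sqrt (2 / Q * ln ((real N + 3) / \<delta>))) \<longrightarrow>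
        exp3_instance N T l lam \<delta> Q \<and>
        68 * sqrt (Q * ln (real N / \<delta>)) \<le> 136 * sqrt (real T * ln (real N / \<delta>)) \<and>
        prob_regret_le N T l lam Q \<beta> (136 * sqrt (real T * ln (real N / \<delta>)))
          \<ge> 1 - \<delta>)" if NT: "2 \<le> N \<and> 1 \<le> T" for N T
  proof (intro exI [of _ "2 * real T"] conjI allI impI; (elim conjE)?)
    show TQ: "2 * real T \<le> 2 * real T" by simp
    fix l lam :: "nat \<Rightarrow> nat \<Rightarrow> real" and \<delta> \<beta> :: real
    assume \<delta>: "0 < \<delta>" "\<delta> < 1"
      and l: "\<forall>i\<in>{1..N}. \<forall>t\<in>{1..T}. l i t \<in> {0..1} \<and> lam i t = l i t"
      and \<beta>: "\<beta> = min 1 (sqrt (2 / (2 * real T) * ln ((real N + 3) / \<delta>)))"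
    show inst: "exp3_instance N T l lam \<delta> (2 * real T)"
      using NT \<delta> l loss_quantity_full_information [OF _ l] by (auto simp: exp3_instance_def)
    have "0 \<le> ln (real N / \<delta>)" using confidence_logs(4) [of N \<delta>] NT \<delta> by simp
    then show le: "68 * sqrt (2 * real T * ln (real N / \<delta>)) \<le> 136 * sqrt (real T * ln (real N / \<delta>))"
      using sqrt_two_mult_le [of "real T * ln (real N / \<delta>)"] by (simp add: mult.assoc)
    have "1 - \<delta> \<le> prob_regret_le N T l lam (2 * real T) \<beta> (68 * sqrt (2 * real T * ln (real N / \<delta>)))"
      using l by (intro exp3_regret_unit_losses [OF inst _ TQ \<beta>]) auto
    also note prob_regret_le_mono [OF le]
    finally show "1 - \<delta> \<le> prob_regret_le N T l lam (2 * real T) \<beta>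
        (136 * sqrt (real T * ln (real N / \<delta>)))" .
  qed
  \<comment> \<open>One constant \<open>C = 68\<close> must serve the general bound and both
    comparisons; \<open>C' = 136\<close> absorbs the factor \<open>sqrt 2\<close> from
    \<open>Q\<close>.\<close>
  show "\<exists>C>0.
        (\<forall>N T l lam \<delta> Q \<beta>.
          exp3_instance N T l lam \<delta> Q \<and>
          (\<forall>i\<in>{1..N}. \<forall>t\<in>{1..T}. l i t \<in> {0..1} \<and> 0 \<le> lam i t) \<and>
          2 * real T \<le> Q \<and>
          \<beta> = min 1 (sqrt (2 / Q * ln ((real N + 3) / \<delta>))) \<longrightarrow>
          prob_regret_le N T l lam Q \<beta> (C * sqrt (Q * ln (real N / \<delta>))) \<ge> 1 - \<delta>) \<and>
        (\<exists>C'>0. \<forall>N T. 2 \<le> N \<and> 1 \<le> T \<longrightarrow>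
          (\<exists>Q. 2 * real T \<le> Q \<and>
            (\<forall>l lam \<delta> \<beta>.
              0 < \<delta> \<and> \<delta> < 1 \<and>
              (\<forall>i\<in>{1..N}. \<forall>t\<in>{1..T}. l i t \<in> {0..1} \<and> lam i t = 0) \<and>
              \<beta> = min 1 (sqrt (2 / Q * ln ((real N + 3) / \<delta>))) \<longrightarrow>
              exp3_instance N T l lam \<delta> Q \<and>
              C * sqrt (Q * ln (real N / \<delta>)) \<le> C' * sqrt (real N * real T * ln (real N / \<delta>)) \<and>
              prob_regret_le N T l lam Q \<beta> (C' * sqrt (real N * real T * ln (real N / \<delta>)))
                \<ge> 1 - \<delta>))) \<and>
        (\<exists>C'>0. \<forall>N T. 2 \<le> N \<and> 1 \<le> T \<longrightarrow>
          (\<exists>Q. 2 * real T \<le> Q \<and>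
            (\<forall>l lam \<delta> \<beta>.
              0 < \<delta> \<and> \<delta> < 1 \<and>
              (\<forall>i\<in>{1..N}. \<forall>t\<in>{1..T}. l i t \<in> {0..1} \<and> lam i t = l i t) \<and>
              \<beta> = min 1 (sqrt (2 / Q * ln ((real N + 3) / \<delta>))) \<longrightarrow>
              exp3_instance N T l lam \<delta> Q \<and>
              C * sqrt (Q * ln (real N / \<delta>)) \<le> C' * sqrt (real T * ln (real N / \<delta>)) \<and>
              prob_regret_le N T l lam Q \<beta> (C' * sqrt (real T * ln (real N / \<delta>)))
                \<ge> 1 - \<delta>)))"
  proof (rule exI [of _ 68], intro conjI)
    show "\<forall>N T l lam \<delta> Q \<beta>.
      exp3_instance N T l lam \<delta> Q \<and>
      (\<forall>i\<in>{1..N}. \<forall>t\<in>{1..T}. l i t \<in> {0..1} \<and> 0 \<le> lam i t) \<and>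
      2 * real T \<le> Q \<and> \<beta> = min 1 (sqrt (2 / Q * ln ((real N + 3) / \<delta>))) \<longrightarrow>
      1 - \<delta> \<le> prob_regret_le N T l lam Q \<beta> (68 * sqrt (Q * ln (real N / \<delta>)))"
      using exp3_regret_unit_losses by blast
  qed (simp,
      rule exI [of _ 136], rule conjI, simp, intro allI impI, erule bandit,
      rule exI [of _ 136], rule conjI, simp, intro allI impI, erule full)
qed

end
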